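(* Let $p$ be a prime. If all $m_i$ are positive integers, then $\dim_{\mathbb{F}_p}\bar B_1(A_n(\mathbb{F}_p))[m_1,\dots,m_n]$ is $2^{n-2}$ if there exists $i$ such that $m_i$ is not divisible by $p$, and $2^{n-1}$ otherwise (i.e., if all $m_i$ are divisible by $p$).
   Context: $A_n(\mathbb{F}_p)$ is the free associative unital $\mathbb{F}_p$-algebra on $x_1,\dots,x_n$, graded by multidegree in the generators. For an algebra $A$, $[a,b]=ab-ba$, $L_1(A)=A$, $L_{k+1}(A)=[A,L_k(A)]$ (linear span of commutators), $M_k(A)=A\,L_k(A)$ (a two-sided ideal), and $\bar B_1(A)=A/(L_2(A)+M_3(A))$. $[m_1,\dots,m_n]$ denotes the component of multidegree $(m_1,\dots,m_n)$.
   Formalization: In the case where some m_i is not divisible by p, n ≥ 2 is assumed: for n = 1 the formula would give 2^{-1}, while the component of F_p[x] has dimension 1. In the other case n ≥ 1 is assumed (n = 0 would also give 2^{-1}). *)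

theory Defs
  imports
    Complex_Main
    "HOL-Computational_Algebra.Primes"
    "HOL-Library.Cardinality"
    "HOL-Library.Poly_Mapping"
begin

section \<open>The free associative unital algebra\<close>

text \<open>
  The free monoid on \<open>'x\<close>, written additively because the convolution product of
  \<^theory>\<open>HOL-Library.Poly_Mapping\<close> is indexed by (not necessarily commutative) additive monoids.
\<close>

datatype 'x word = Word (letters: "'x list")

instantiation word :: (type) monoid_add
begin

definition zero_word :: "'a word" where
  "0 = Word []"

definition plus_word :: "'a word \<Rightarrow> 'a word \<Rightarrow> 'a word" where
  "u + v = Word (letters u @ letters v)"

instance
  by standard (simp_all add: zero_word_def plus_word_def)

end

text \<open>
  The monoid algebra over \<open>'k\<close> of the free monoid on \<open>'x\<close>; the generator \<open>x\<^sub>i\<close> is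
  \<open>Poly_Mapping.single (Word [i]) 1\<close>. For \<open>CARD('x) = n\<close> and \<open>CARD('k) = p\<close> prime this is
  \<open>A\<^sub>n(\<bbbF>\<^sub>p)\<close>. The whole type is the algebra.
\<close>

type_synonym ('x, 'k) free_algebra = "'x word \<Rightarrow>\<^sub>0 'k"

definition fa_scale :: "'k::field \<Rightarrow> ('x, 'k) free_algebra \<Rightarrow> ('x, 'k) free_algebra" where
  "fa_scale c f = Poly_Mapping.map ((*) c) f"

lemma lookup_fa_scale: "Poly_Mapping.lookup (fa_scale c f) w = c * Poly_Mapping.lookup f w"
  by (simp add: fa_scale_def Poly_Mapping.map.rep_eq when_def)

global_interpretation fa: vector_space fa_scale
  by standard (simp_all add: poly_mapping_eq_iff fun_eq_iff lookup_fa_scale lookup_add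
      distrib_left distrib_right mult.assoc)

definition fa_component :: "('x \<Rightarrow> nat) \<Rightarrow> ('x, 'k::field) free_algebra set" where
  "fa_component m = {f. \<forall>w\<in>Poly_Mapping.keys f. \<forall>i. count_list (letters w) i = m i}"


section \<open>Lower central series\<close>

text \<open>
  For an algebra given by a ring type \<open>'a\<close> and a scalar multiplication \<open>s\<close>. The value at
  index \<open>0\<close> is junk; the series starts at index \<open>1\<close>.
\<close>

definition commutator :: "'a::ring \<Rightarrow> 'a \<Rightarrow> 'a" where
  "commutator a b = a * b - b * a"

fun lower_central :: "('k::field \<Rightarrow> 'a::ring_1 \<Rightarrow> 'a) \<Rightarrow> nat \<Rightarrow> 'a set" where
  "lower_central s 0 = UNIV"
| "lower_central s (Suc 0) = UNIV"
| "lower_central s (Suc (Suc k)) =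
     module.span s {commutator a b | a b. b \<in> lower_central s (Suc k)}"

definition lower_central_ideal :: "('k::field \<Rightarrow> 'a::ring_1 \<Rightarrow> 'a) \<Rightarrow> nat \<Rightarrow> 'a set" where
  "lower_central_ideal s k = module.span s {a * b | a b. b \<in> lower_central s k}"

definition B1bar_kernel :: "('k::field \<Rightarrow> 'a::ring_1 \<Rightarrow> 'a) \<Rightarrow> 'a set" where
  "B1bar_kernel s = {u + v | u v. u \<in> lower_central s 2 \<and> v \<in> lower_central_ideal s 3}"

lemma subspace_B1bar_kernel: "fa.subspace (B1bar_kernel fa_scale)"
  unfolding B1bar_kernel_def lower_central_ideal_def numeral_2_eq_2 lower_central.simps
  by (intro fa.subspace_sums fa.subspace_span)


section \<open>The quotient \<open>A / (L\<^sub>2(A) + M\<^sub>3(A))\<close> of the free algebra\<close>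

definition B1bar_rel :: "('x, 'k::field) free_algebra \<Rightarrow> ('x, 'k) free_algebra \<Rightarrow> bool" where
  "B1bar_rel f g \<longleftrightarrow> f - g \<in> B1bar_kernel fa_scale"

lemma equivp_B1bar_rel: "equivp (B1bar_rel :: ('x, 'k::field) free_algebra \<Rightarrow> _)" (is "equivp ?R")
proof (rule equivpI)
  show "reflp ?R"
    by (simp add: reflp_def B1bar_rel_def fa.subspace_0[OF subspace_B1bar_kernel])
  show "symp ?R"
  proof (rule sympI)
    fix f g :: "('x, 'k) free_algebra"
    assume "B1bar_rel f g"
    then show "B1bar_rel g f"
      using fa.subspace_neg[OF subspace_B1bar_kernel, of "f - g"] by (simp add: B1bar_rel_def)
  qed
  show "transp ?R"
  proof (rule transpI)
    fix f g h :: "('x, 'k) free_algebra"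
    assume "B1bar_rel f g" "B1bar_rel g h"
    then show "B1bar_rel f h"
      using fa.subspace_add[OF subspace_B1bar_kernel, of "f - g" "g - h"]
      by (simp add: B1bar_rel_def)
  qed
qed

quotient_type (overloaded) ('x, 'k) B1bar = "('x, 'k::field) free_algebra" / B1bar_rel
  morphisms rep_B1bar B1bar_class
  by (rule equivp_B1bar_rel)

instantiation B1bar :: (type, field) ab_group_add
begin

lift_definition zero_B1bar :: "('a, 'b) B1bar" is 0 .

lift_definition plus_B1bar :: "('a, 'b) B1bar \<Rightarrow> ('a, 'b) B1bar \<Rightarrow> ('a, 'b) B1bar" is "(+)"
proof -
  fix f f' g g' :: "('a, 'b) free_algebra"
  assume "B1bar_rel f f'" "B1bar_rel g g'"
  then show "B1bar_rel (f + g) (f' + g')"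
    using fa.subspace_add[OF subspace_B1bar_kernel, of "f - f'" "g - g'"]
    by (simp add: B1bar_rel_def add_diff_add)
qed

lift_definition uminus_B1bar :: "('a, 'b) B1bar \<Rightarrow> ('a, 'b) B1bar" is uminus
proof -
  fix f f' :: "('a, 'b) free_algebra"
  assume "B1bar_rel f f'"
  then show "B1bar_rel (- f) (- f')"
    using fa.subspace_neg[OF subspace_B1bar_kernel, of "f - f'"]
    by (simp add: B1bar_rel_def)
qed

lift_definition minus_B1bar :: "('a, 'b) B1bar \<Rightarrow> ('a, 'b) B1bar \<Rightarrow> ('a, 'b) B1bar" is "(-)"
proof -
  fix f f' g g' :: "('a, 'b) free_algebra"
  assume "B1bar_rel f f'" "B1bar_rel g g'"
  moreover have "(f - g) - (f' - g') = (f - f') - (g - g')"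
    by simp
  ultimately show "B1bar_rel (f - g) (f' - g')"
    using fa.subspace_diff[OF subspace_B1bar_kernel, of "f - f'" "g - g'"]
    by (simp only: B1bar_rel_def)
qed

instance
proof
  fix a b c :: "('a, 'b) B1bar"
  note refl = equivp_reflp[OF equivp_B1bar_rel]
  show "a + b + c = a + (b + c)"
    by transfer (simp only: add.assoc refl)
  show "a + b = b + a"
    by transfer (simp only: add.commute refl)
  show "0 + a = a"
    by transfer (simp only: add_0 refl)
  show "- a + a = 0"
    by transfer (simp only: left_minus refl)
  show "a - b = a + - b"
    by transfer (simp only: diff_conv_add_uminus refl)
qed

end

lift_definition B1bar_scale :: "'k::field \<Rightarrow> ('x, 'k) B1bar \<Rightarrow> ('x, 'k) B1bar" is fa_scale
proof -
  fix c :: 'k and f f' :: "('x, 'k) free_algebra"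
  assume "B1bar_rel f f'"
  then show "B1bar_rel (fa_scale c f) (fa_scale c f')"
    using fa.subspace_scale[OF subspace_B1bar_kernel, of "f - f'" c]
    by (simp only: B1bar_rel_def fa.scale_right_diff_distrib)
qed

global_interpretation B1bar: vector_space "B1bar_scale :: 'k::field \<Rightarrow> ('x, 'k) B1bar \<Rightarrow> _"
proof
  fix c d :: 'k and a b :: "('x, 'k) B1bar"
  note refl = equivp_reflp[OF equivp_B1bar_rel]
  show "B1bar_scale c (a + b) = B1bar_scale c a + B1bar_scale c b"
    by transfer (simp only: fa.scale_right_distrib refl)
  show "B1bar_scale (c + d) a = B1bar_scale c a + B1bar_scale d a"
    by transfer (simp only: fa.scale_left_distrib refl)
  show "B1bar_scale c (B1bar_scale d a) = B1bar_scale (c * d) a"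
    by transfer (simp only: fa.scale_scale refl)
  show "B1bar_scale 1 a = a"
    by transfer (simp only: fa.scale_one refl)
qed

text \<open>
  The kernel is a multigraded subspace, so the component of multidegree \<open>m\<close> of the quotient
  is the image of the component of the free algebra.
\<close>

definition B1bar_component :: "('x \<Rightarrow> nat) \<Rightarrow> ('x, 'k::field) B1bar set" where
  "B1bar_component m = B1bar_class ` fa_component m"

end

theory Submission
  imports Defs "HOL-Library.Function_Algebras" "HOL-Library.Countable" "HOL-Library.Multiset"
begin

text \<open>
  Write \<open>A\<close> for the free algebra and \<open>u\<^sub>i\<^sub>j = [x\<^sub>i, x\<^sub>j]\<close>. The quotient \<open>A / M\<^sub>3\<close> behaves like the space
  of even polynomial differential forms, with \<open>u\<^sub>i\<^sub>j\<close> in the role of \<open>dx\<^sub>i \<and> dx\<^sub>j\<close>. Indeed commutators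
  are central modulo \<open>M\<^sub>3\<close>, and the identity \<open>[a, b] [a, d] \<in> M\<^sub>3\<close> makes products of commutators
  alternating in the generators. Hence in a multidegree \<open>m\<close> with positive entries the quotient is
  spanned by one element \<open>x\<^sup>a u\<^sub>S\<close> for each subset \<open>S\<close> of even size of the index set. The commutator
  \<open>[f, g]\<close> corresponds to the exact form \<open>df \<and> dg\<close>, and \<open>L\<^sub>2\<close> becomes the image of the odd forms
  under \<open>d\<close>.

  In terms of the logarithmic forms \<open>\<omega>\<^sub>i = dx\<^sub>i / x\<^sub>i\<close> the forms of multidegree \<open>m\<close> are an exterior
  algebra on \<open>n\<close> generators, and there \<open>d\<close> is multiplication by \<open>\<eta> = \<Sum>\<^sub>i m\<^sub>i \<omega>\<^sub>i\<close>. If \<open>p\<close> divides all \<open>m\<^sub>i\<close>, then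
  \<open>\<eta> = 0\<close>, nothing is exact, and the even subsets of the index set give the dimension
  \<open>2\<^sup>n\<^sup>-\<^sup>1\<close>. If some \<open>m\<^sub>i\<close> is nonzero in the field, \<open>\<eta>\<close> can replace \<open>\<omega>\<^sub>i\<close> as a generator, and what
  survives modulo \<open>\<eta>\<close> is indexed by the even subsets that avoid \<open>i\<close>, whose number is \<open>2\<^sup>n\<^sup>-\<^sup>2\<close> if \<open>n \<ge> 2\<close>.

  The upper bound (\<open>mon_comm_prod_mem\<close>) is a rewriting argument in \<open>A\<close>: words are sorted at the
  price of shorter words with more commutators, and exact elements eliminate \<open>i\<close>. For the lower
  bound each word receives a symbol in an exterior algebra (\<open>symb\<close>), defined by ordering its letters.
  The formula \<open>symb_swap\<close>, which says that exchanging two factors \<open>u\<close> and \<open>v\<close> multiplies the symbol by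
  \<open>1 + \<eta> u * \<eta> v\<close>, implies at once that double commutators have symbol zero and that commutators have
  symbols divisible by \<open>\<eta>\<close>. Coefficients of the symbol, after multiplication by \<open>\<eta>\<close> in the second
  case, are then functionals on the quotient that are dual to the spanning family
  (\<open>dim_component_eq_card_even_subsets\<close>). Since the ordered symbol involves no division, the argument
  includes \<open>p = 2\<close>.
\<close>

section \<open>Words and linear extension\<close>

definition mon :: "'x list \<Rightarrow> ('x, 'k::field) free_algebra" where
  "mon w = Poly_Mapping.single (Word w) 1"

lemma mon_Nil [simp]: "mon [] = 1"
  by (simp add: mon_def flip: zero_word_def)

lemma mon_append: "mon (u @ v) = mon u * mon v"
  by (simp add: mon_def mult_single plus_word_def)

lemma mon_Cons: "mon (i # w) = mon [i] * mon w"
  using mon_append[of "[i]" w] by simp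

lemma mon_split: "mon (u @ [i, j] @ v) = mon u * mon [i] * mon [j] * mon v"
  by (metis append_Cons append_Nil mon_append mult.assoc)

lemma fa_scale_left: "fa_scale c f * g = fa_scale c (f * g)"
  by (simp add: fa_scale_def mult_map_scale_conv_mult mult.assoc)

lemma sum_singles:
  "f = (\<Sum>w\<in>Poly_Mapping.keys f. Poly_Mapping.single w (Poly_Mapping.lookup f w))"
  by (rule poly_mapping_eqI)
    (simp add: lookup_sum lookup_single when_def in_keys_iff flip: of_bool_def cong: if_cong)

lemma single_0_commute:
  "f * Poly_Mapping.single 0 c = Poly_Mapping.single 0 c * (f :: ('x, 'k::field) free_algebra)"
  by (subst (1 2) sum_singles[of f])
    (simp add: sum_distrib_left sum_distrib_right mult_single mult.commute)

lemma fa_scale_right: "f * fa_scale c g = fa_scale c (f * g)"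
proof -
  have "f * fa_scale c g = f * Poly_Mapping.single 0 c * g"
    by (simp add: fa_scale_def mult_map_scale_conv_mult mult.assoc)
  also have "f * Poly_Mapping.single 0 c = Poly_Mapping.single 0 c * f"
    by (rule single_0_commute)
  finally show ?thesis
    by (simp add: fa_scale_def mult_map_scale_conv_mult mult.assoc)
qed

lemma fa_scale_mon: "fa_scale c (mon w) = Poly_Mapping.single (Word w) c"
  by (simp add: fa_scale_def mon_def)

lemma sum_monomials: "f = (\<Sum>w\<in>Poly_Mapping.keys f. fa_scale (Poly_Mapping.lookup f w) (mon (letters w)))"
  by (subst sum_singles) (simp add: fa_scale_mon)

text \<open>
  Identities that are linear in one argument are checked on words through this lemma.
\<close>

lemma span_monomials:
  assumes "fa.subspace P" "\<And>w. mon w \<in> P"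
  shows "f \<in> P"
  by (subst sum_monomials) (intro fa.subspace_sum fa.subspace_scale assms)

definition lin_ext :: "('x list \<Rightarrow> 'k::field) \<Rightarrow> ('x, 'k) free_algebra \<Rightarrow> 'k" where
  "lin_ext c f = (\<Sum>w\<in>Poly_Mapping.keys f. Poly_Mapping.lookup f w * c (letters w))"

lemma lin_ext_superset:
  "finite A \<Longrightarrow> Poly_Mapping.keys f \<subseteq> A \<Longrightarrow>
    lin_ext c f = (\<Sum>w\<in>A. Poly_Mapping.lookup f w * c (letters w))"
  unfolding lin_ext_def by (rule sum.mono_neutral_left) (auto simp: in_keys_iff)

lemma lin_ext_add: "lin_ext c (f + g) = lin_ext c f + lin_ext c g"
proof -
  let ?A = "Poly_Mapping.keys f \<union> Poly_Mapping.keys g"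
  have "lin_ext c h = (\<Sum>w\<in>?A. Poly_Mapping.lookup h w * c (letters w))" if "h \<in> {f, g, f + g}" for h
    using that by (intro lin_ext_superset) (auto dest: subsetD[OF keys_add])
  then show ?thesis
    by (simp add: lookup_add distrib_right sum.distrib)
qed

lemma lin_ext_scale: "lin_ext c (fa_scale a f) = a * lin_ext c f"
proof -
  have "lin_ext c (fa_scale a f) = (\<Sum>w\<in>Poly_Mapping.keys f. Poly_Mapping.lookup (fa_scale a f) w * c (letters w))"
    by (intro lin_ext_superset) (auto simp: in_keys_iff lookup_fa_scale)
  then show ?thesis
    by (simp add: lin_ext_def lookup_fa_scale sum_distrib_left mult.assoc)
qed

lemma lin_ext_mon [simp]: "lin_ext c (mon w) = c w"
  by (simp add: lin_ext_def mon_def)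

lemma lin_ext_0 [simp]: "lin_ext c 0 = 0"
  by (simp add: lin_ext_def)

lemma lin_ext_diff: "lin_ext c (f - g) = lin_ext c f - lin_ext c g"
  using lin_ext_add[of c "f - g" g] by simp

lemma subspace_lin_ext_kernel: "fa.subspace {f. lin_ext c f = 0}"
  by (rule fa.subspaceI) (simp_all add: lin_ext_add lin_ext_scale)

section \<open>The ideal generated by double commutators\<close>

lemma lower_central_2_eq:
  "lower_central fa_scale 2 = fa.span {commutator a b | a b. True}"
  by (simp add: numeral_2_eq_2)

lemma commutator_in_lower_central_2: "commutator a b \<in> lower_central fa_scale 2"
  by (auto simp: lower_central_2_eq intro: fa.span_base)

lemma lower_central_3_eq:
  "lower_central fa_scale 3 = fa.span {commutator a b | a b. b \<in> lower_central fa_scale 2}"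
  by (simp add: numeral_3_eq_3 numeral_2_eq_2)

abbreviation M3 :: "('x, 'k::field) free_algebra set" where
  "M3 \<equiv> lower_central_ideal fa_scale 3"

lemma subspace_M3: "fa.subspace M3"
  by (simp add: lower_central_ideal_def)

lemma M3_I: "b \<in> lower_central fa_scale 3 \<Longrightarrow> a * b \<in> M3"
  unfolding lower_central_ideal_def by (rule fa.span_base) auto

lemma M3_double_commutator: "z * commutator a (commutator b c) \<in> M3"
  by (intro M3_I) (auto simp: lower_central_3_eq intro!: fa.span_base commutator_in_lower_central_2)

lemma M3_left: 
  assumes "y \<in> M3" shows "z * y \<in> M3"
proof -
  have "M3 \<subseteq> {y. z * y \<in> M3}"
    unfolding lower_central_ideal_def
  proof (rule fa.span_minimal)
    show "fa.subspace {y. z * y \<in> fa.span {a * b |a b. b \<in> lower_central fa_scale 3}}"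
      by (rule fa.subspaceI) (simp_all add: distrib_left fa_scale_right fa.span_add fa.span_scale fa.span_zero)
  next
    show "{a * b |a b. b \<in> lower_central fa_scale 3}
        \<subseteq> {y. z * y \<in> fa.span {a * b |a b. b \<in> lower_central fa_scale 3}}"
      using M3_I[of _ "z * _"] by (auto simp: lower_central_ideal_def simp flip: mult.assoc)
  qed
  with assms show ?thesis by auto
qed

lemma lower_central_3_commutator:
  assumes "b \<in> lower_central fa_scale 3" shows "commutator a b \<in> lower_central fa_scale 3"
proof -
  have "lower_central fa_scale 3 \<subseteq> lower_central fa_scale 2"
    unfolding lower_central_3_eq lower_central_2_eq by (rule fa.span_mono) auto
  with assms show ?thesis
    unfolding lower_central_3_eq[of] by (auto intro: fa.span_base)
qed

text \<open>
  The commutator of an element of \<open>L\<^sub>3\<close> with anything is again in \<open>L\<^sub>3\<close>, because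
  \<open>L\<^sub>3 \<subseteq> L\<^sub>2\<close>; so the left ideal generated by \<open>L\<^sub>3\<close> is two-sided.
\<close>

lemma M3_right:
  assumes "y \<in> M3" shows "y * z \<in> M3"
proof -
  have "M3 \<subseteq> {y. y * z \<in> M3}"
  proof (subst lower_central_ideal_def, rule fa.span_minimal)
    show "fa.subspace {y. y * z \<in> M3}"
      by (rule fa.subspaceI)
        (simp_all add: distrib_right fa_scale_left fa.subspace_add fa.subspace_scale
          fa.subspace_0 subspace_M3)
    have "a * b * z \<in> M3" if "b \<in> lower_central fa_scale 3" for a b
    proof -
      have "a * b * z = (a * z) * b - a * commutator z b"
        by (simp add: commutator_def algebra_simps)
      then show ?thesis
        using that by (simp add: M3_I fa.subspace_diff subspace_M3 lower_central_3_commutator)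
    qed
    then show "{a * b |a b. b \<in> lower_central fa_scale 3} \<subseteq> {y. y * z \<in> M3}"
      by auto
  qed
  with assms show ?thesis by auto
qed

lemma M3_B1bar_kernel: "M3 \<subseteq> B1bar_kernel fa_scale"
proof
  fix y assume "y \<in> (M3 :: ('x, 'k::field) free_algebra set)"
  then have "0 + y \<in> B1bar_kernel fa_scale"
    unfolding B1bar_kernel_def lower_central_2_eq using fa.span_zero by blast
  then show "y \<in> B1bar_kernel fa_scale" by simp
qed

lemma commutator_B1bar_kernel: "commutator a b \<in> B1bar_kernel fa_scale"
proof -
  have "commutator a b + 0 \<in> B1bar_kernel fa_scale"
    unfolding B1bar_kernel_def using commutator_in_lower_central_2 fa.subspace_0[OF subspace_M3] by blast
  then show ?thesis by simp
qed

text \<open>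
  Since \<open>[a, b] a = [a, b a]\<close>, the commutator of this element with \<open>d\<close> lies in \<open>L\<^sub>3\<close>; the
  Leibniz rule expands it into \<open>[a, b] [a, d]\<close> up to \<open>[[a, b], d] a\<close>. No division by two occurs,
  so the argument covers characteristic two. The next lemma is the polarization.
\<close>

lemma M3_repeated: "commutator a b * commutator a d \<in> M3"
proof -
  have "commutator a b * commutator a d
      = 1 * commutator d (commutator a b) * a - 1 * commutator d (commutator a (b * a))"
    by (simp add: commutator_def algebra_simps)
  also have "\<dots> \<in> M3"
    by (intro fa.subspace_diff subspace_M3 M3_right M3_double_commutator)
  finally show ?thesis .
qed

lemma M3_exchange: "commutator a b * commutator c d + commutator c b * commutator a d \<in> M3"
proof -
  have "commutator a b * commutator c d + commutator c b * commutator a d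
    = commutator (a + c) b * commutator (a + c) d
      - commutator a b * commutator a d - commutator c b * commutator c d"
    by (simp add: commutator_def algebra_simps)
  also have "\<dots> \<in> M3"
    by (intro fa.subspace_diff subspace_M3 M3_repeated)
  finally show ?thesis .
qed

text \<open>
  The word \<open>s\<^sub>1 \<dots> s\<^sub>2\<^sub>k\<close> gives \<open>[x\<^sub>s\<^sub>1, x\<^sub>s\<^sub>2] \<cdots> [x\<^sub>s\<^sub>2\<^sub>k\<^sub>-\<^sub>1, x\<^sub>s\<^sub>2\<^sub>k]\<close>, the analogue
  of the differential form \<open>dx\<^sub>s\<^sub>1 \<and> \<dots> \<and> dx\<^sub>s\<^sub>2\<^sub>k\<close>. Words of odd length give \<open>0\<close>, which lets
  the statements below range over all words.
\<close>

fun comm_prod :: "'x list \<Rightarrow> ('x, 'k::field) free_algebra" where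
  "comm_prod [] = 1"
| "comm_prod [i] = 0"
| "comm_prod (i # j # s) = commutator (mon [i]) (mon [j]) * comm_prod s"

lemma comm_prod_odd: "odd (length s) \<Longrightarrow> comm_prod s = 0"
  by (induction s rule: comm_prod.induct) simp_all

text \<open>
  Modulo \<open>M\<^sub>3\<close> the product is antisymmetric in all its letters. Within a factor this is trivial;
  across two adjacent factors it is the exchange relation.
\<close>

lemma comm_prod_swap: "comm_prod (s @ [i, j] @ t) + comm_prod (s @ [j, i] @ t) \<in> M3"
proof (induction s rule: comm_prod.induct)
  case 1
  then show ?case
    by (simp add: commutator_def algebra_simps fa.subspace_0[OF subspace_M3])
next
  case (2 a)
  show ?case
  proof (cases t)
    case Nil
    then show ?thesis by (simp add: fa.subspace_0[OF subspace_M3])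
  next
    case (Cons b t')
    let ?c = "\<lambda>i j. commutator (mon [i]) (mon [j])"
    have "?c a i * ?c j b + ?c a j * ?c i b = - (?c i a * ?c j b + ?c j a * ?c i b)"
      by (simp add: commutator_def algebra_simps)
    also have "\<dots> \<in> M3"
      by (intro fa.subspace_neg subspace_M3 M3_exchange)
    finally have "(?c a i * ?c j b + ?c a j * ?c i b) * comm_prod t' \<in> M3"
      by (rule M3_right)
    then show ?thesis
      by (simp add: Cons mult.assoc distrib_right)
  qed
next
  case (3 a b s)
  then show ?case
    using M3_left[of _ "commutator (mon [a]) (mon [b])"] by (simp add: distrib_left[symmetric])
qed

lemma comm_prod_central: "commutator a (comm_prod s) \<in> M3"
proof (induction s rule: comm_prod.induct)
  case (3 i j s)
  let ?c = "commutator (mon [i]) (mon [j])"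
  have "commutator a (?c * comm_prod s)
      = 1 * commutator a ?c * comm_prod s + ?c * commutator a (comm_prod s)"
    by (simp add: commutator_def algebra_simps)
  also have "\<dots> \<in> M3"
    by (intro fa.subspace_add subspace_M3 M3_right M3_left M3_double_commutator "3.IH")
  finally show ?case by simp
qed (simp_all add: commutator_def fa.subspace_0[OF subspace_M3])

text \<open>
  Reordering a word costs a word that is shorter by two, multiplied by one more commutator. This
  is what drives the reduction of arbitrary words to ordered ones.
\<close>

lemma mon_swap:
  "mon (u @ [i, j] @ v) * comm_prod s - mon (u @ [j, i] @ v) * comm_prod s
    - mon (u @ v) * comm_prod (i # j # s) \<in> M3"
proof -
  let ?c = "commutator (mon [i]) (mon [j])"
  have "mon (u @ [i, j] @ v) * comm_prod s - mon (u @ [j, i] @ v) * comm_prod s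
      - mon (u @ v) * comm_prod (i # j # s) = - (mon u * commutator (mon v) ?c) * comm_prod s"
    by (simp only: mon_split) (simp add: mon_append commutator_def algebra_simps)
  also have "\<dots> = - (mon u * commutator (mon v) ?c * comm_prod s)"
    by simp
  also have "\<dots> \<in> M3"
    by (intro fa.subspace_neg subspace_M3 M3_right M3_double_commutator)
  finally show ?thesis .
qed

text \<open>
  The form \<open>dx\<^sub>i \<and> d(v dx\<^sub>s)\<close>: commutation with \<open>x\<^sub>i\<close> is a derivation, and modulo \<open>M\<^sub>3\<close>
  the commutators of generators that it produces are central and can be collected on the right.
\<close>

lemma commutator_expand:
  fixes i :: 'x
  shows "(commutator (mon [i]) (mon v * comm_prod s) :: ('x, 'k::field) free_algebra)
    - (\<Sum>k<length v. mon (take k v @ drop (Suc k) v) * comm_prod (i # v ! k # s)) \<in> M3"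
proof (induction v)
  case Nil
  then show ?case by (simp add: comm_prod_central)
next
  case (Cons j v)
  let ?c = "commutator (mon [i]) (mon [j]) :: ('x, 'k) free_algebra"
  let ?S = "\<Sum>k<length v. mon (take k v @ drop (Suc k) v) * comm_prod (i # v ! k # s) :: ('x, 'k) free_algebra"
  have sum: "(\<Sum>k<length (j # v). mon (take k (j # v) @ drop (Suc k) (j # v)) * comm_prod (i # (j # v) ! k # s))
    = mon v * (?c * comm_prod s) + mon [j] * ?S"
    by (simp add: sum.lessThan_Suc_shift sum_distrib_left mon_Cons[of j "_ @ _"] mult.assoc del: sum.lessThan_Suc)
  have "commutator (mon [i]) (mon [j] * mon v * comm_prod s)
      - (mon v * (?c * comm_prod s) + mon [j] * S)
     = mon [j] * (commutator (mon [i]) (mon v * comm_prod s) - S)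
       - 1 * commutator (mon v) ?c * comm_prod s" for S
    by (simp add: commutator_def algebra_simps)
  then have "commutator (mon [i]) (mon (j # v) * comm_prod s)
     - (\<Sum>k<length (j # v). mon (take k (j # v) @ drop (Suc k) (j # v)) * comm_prod (i # (j # v) ! k # s))
     = mon [j] * (commutator (mon [i]) (mon v * comm_prod s) - ?S)
       - 1 * commutator (mon v) ?c * comm_prod s"
    unfolding sum mon_Cons[of j v] .
  also have "\<dots> \<in> M3"
    by (intro fa.subspace_diff[OF subspace_M3 M3_left[OF Cons.IH] M3_right[OF M3_double_commutator]])
  finally show ?case .
qed

section \<open>Reduction to ordered words times commutators\<close>

text \<open>
  Bubble sort: adjacent transpositions generate all permutations of a word.
\<close>

lemma permutation_invariant:
  assumes swap: "\<And>a i j b. Q (a @ [i, j] @ b) \<Longrightarrow> Q (a @ [j, i] @ b)"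
    and "mset xs = mset ys" and "Q xs"
  shows "Q ys"
  using assms
proof (induction ys arbitrary: xs Q)
  case (Cons y ys)
  have front: "Q (a @ y # b) \<Longrightarrow> Q (y # a @ b)" for a b
  proof (induction a arbitrary: b rule: rev_induct)
    case (snoc z a)
    then show ?case
      using Cons.prems(1)[of a z y b] snoc.IH[of "z # b"] by simp
  qed simp
  have "y \<in> set xs"
    using Cons.prems(2) by (metis list.set_intros(1) set_mset_mset)
  then obtain a b where xs: "xs = a @ y # b"
    by (meson split_list)
  with Cons.prems front have "Q (y # a @ b)" "mset (a @ b) = mset ys"
    by simp_all
  moreover have "Q (y # c @ [i, j] @ d) \<Longrightarrow> Q (y # c @ [j, i] @ d)" for c i j d
    using Cons.prems(1)[of "y # c" i j d] by simp
  ultimately show ?case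
    using Cons.IH[of "\<lambda>l. Q (y # l)" "a @ b"] by blast
qed simp

definition ordered_word :: "('x \<Rightarrow> nat) \<Rightarrow> ('x \<Rightarrow> nat) \<Rightarrow> 'x list" where
  "ordered_word r a = (SOME w. sorted (map r w) \<and> (\<forall>i. count_list w i = a i))"

lemma
  fixes a :: "'x::finite \<Rightarrow> nat"
  shows sorted_ordered_word: "sorted (map r (ordered_word r a))"
    and count_ordered_word [simp]: "count_list (ordered_word r a) i = a i"
proof -
  obtain w where w: "mset w = Abs_multiset a"
    using ex_mset by blast
  have "sorted (map r (sort_key r w)) \<and> (\<forall>i. count_list (sort_key r w) i = a i)"
    using w by (simp flip: count_mset)
  then have "\<exists>w. sorted (map r w) \<and> (\<forall>i. count_list w i = a i)"
    by blast
  from someI_ex[OF this] show "sorted (map r (ordered_word r a))"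
    and "count_list (ordered_word r a) i = a i"
    by (simp_all add: ordered_word_def)
qed

lemma mset_eq_iff_count_list: "mset v = mset w \<longleftrightarrow> (\<forall>i. count_list v i = count_list w i)"
  by (simp add: multiset_eq_iff count_mset)

lemma count_list_distinct: "distinct s \<Longrightarrow> count_list s i = of_bool (i \<in> set s)"
  by (induction s) auto

lemma 
  fixes S :: "'x::finite set"
  shows set_ordered_subset [simp]: "set (ordered_word r (\<lambda>i. of_bool (i \<in> S))) = S"
    and distinct_ordered_subset [simp]: "distinct (ordered_word r (\<lambda>i. of_bool (i \<in> S)))"
proof -
  let ?s = "ordered_word r (\<lambda>i. of_bool (i \<in> S))"
  show "set ?s = S"
  proof (rule set_eqI)
    show "x \<in> set ?s \<longleftrightarrow> x \<in> S" for x
      using count_list_0_iff[of ?s x] by (cases "x \<in> S") simp_all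
  qed
  then show "distinct ?s"
    by (simp add: distinct_count_atmost_1 count_mset)
qed

text \<open>
  The element that corresponds to the monomial form \<open>x\<^sup>a dx\<^sub>S\<close> of total multidegree \<open>m\<close>.
\<close>

definition basis_element ::
    "('x \<Rightarrow> nat) \<Rightarrow> ('x \<Rightarrow> nat) \<Rightarrow> 'x set \<Rightarrow> ('x, 'k::field) free_algebra" where
  "basis_element r m S =
     mon (ordered_word r (\<lambda>i. m i - of_bool (i \<in> S))) *
     comm_prod (ordered_word r (\<lambda>i. of_bool (i \<in> S)))"

lemma sum_positions:
  "(\<Sum>k<length v. if v ! k = i then y else 0) = fa_scale (of_nat (count_list v i)) y"
proof (induction v)
  case (Cons j v)
  then show ?case
    by (simp add: sum.lessThan_Suc_shift fa.scale_left_distrib del: sum.lessThan_Suc)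
qed simp

text \<open>
  The spanning half of the theorem. The set \<open>Z\<close> is empty, or consists of one index \<open>i\<close> whose
  exponent is nonzero in the field, and only the basis elements of sets \<open>S\<close> that avoid \<open>Z\<close> are
  needed. The induction is on the length of the word factor, since a reordering of the word costs
  only terms with a shorter word.
  
  To remove \<open>i\<close> from \<open>s = t i T\<close>, the word \<open>i w\<close> is used: the commutator of \<open>x\<^sub>t\<close> with
  \<open>x\<^sub>i w u\<^sub>T\<close> lies in \<open>L\<^sub>2\<close>, and it expands into one summand for each position of \<open>i w\<close>. The
  \<open>m i\<close> positions that carry \<open>i\<close> all give \<open>w u\<^sub>s\<close> up to reordering, and every other position gives
  a term without \<open>i\<close> in its commutators, or with a repeated letter. So \<open>m i\<close> times \<open>w u\<^sub>s\<close> is a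
  combination of terms that are already under control.
\<close>

lemma mon_comm_prod_mem:
  fixes W :: "('x::finite, 'k::field) free_algebra set"
  assumes W: "fa.subspace W" and K: "B1bar_kernel fa_scale \<subseteq> W"
    and basis: "\<And>S. even (card S) \<Longrightarrow> S \<inter> Z = {} \<Longrightarrow> basis_element r m S \<in> W"
    and Z: "Z = {} \<or> (\<exists>i. Z = {i} \<and> of_nat (m i) \<noteq> (0 :: 'k))"
    and deg: "\<And>i. count_list w i + count_list s i = m i"
  shows "mon w * comm_prod s \<in> W"
  using deg
proof (induction "length w" arbitrary: w s rule: less_induct)
  case less
  note [intro] = fa.subspace_diff[OF W] fa.subspace_add[OF W] fa.subspace_neg[OF W]
  have M3: "f \<in> W" if "f \<in> M3" for f
    using that M3_B1bar_kernel K by blast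
  \<comment> \<open>Here the induction hypothesis absorbs the shorter words that a reordering produces.\<close>
  have reorder: "mon v' * comm_prod s' - mon v * comm_prod s' \<in> W"
    if v': "mset v = mset v'" and len: "length v = length w"
      and deg: "\<And>i. count_list v i + count_list s' i = m i" for v v' s'
  proof -
    let ?Q = "\<lambda>u. mset u = mset v \<longrightarrow> mon u * comm_prod s' - mon v * comm_prod s' \<in> W"
    have "?Q v'"
    proof (rule permutation_invariant[where Q = ?Q, OF _ v'])
      fix a b i j
      assume Q: "?Q (a @ [i, j] @ b)"
      show "?Q (a @ [j, i] @ b)"
      proof
        assume m: "mset (a @ [j, i] @ b) = mset v"
        have "mon (a @ b) * comm_prod (i # j # s') \<in> W"
        proof (rule less.hyps)
          show "length (a @ b) < length w"
            using arg_cong[OF m, of size] len by simp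
          show "count_list (a @ b) k + count_list (i # j # s') k = m k" for k
            using arg_cong[OF m, of "\<lambda>M. count M k"] deg[of k] by (auto simp: count_mset split: if_splits)
        qed
        moreover have "mon (a @ [i, j] @ b) * comm_prod s' - mon v * comm_prod s' \<in> W"
          using Q m by (simp add: add_mset_commute)
        moreover note M3[OF mon_swap[of a i j b s']]
        ultimately have "(mon (a @ [i, j] @ b) * comm_prod s' - mon v * comm_prod s')
          - (mon (a @ [i, j] @ b) * comm_prod s' - mon (a @ [j, i] @ b) * comm_prod s'
             - mon (a @ b) * comm_prod (i # j # s')) - mon (a @ b) * comm_prod (i # j # s') \<in> W"
          by blast
        then show "mon (a @ [j, i] @ b) * comm_prod s' - mon v * comm_prod s' \<in> W"
          by simp
      qed
    qed (simp add: fa.subspace_0[OF W])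
    then show ?thesis
      by (simp add: v')
  qed
  have permute: "mon v * comm_prod s2 \<in> W" if "mset s1 = mset s2" "mon v * comm_prod s1 \<in> W" for v s1 s2
  proof (rule permutation_invariant[where Q = "\<lambda>s. mon v * comm_prod s \<in> W", OF _ that])
    fix a b i j
    assume "mon v * comm_prod (a @ [i, j] @ b) \<in> W"
    moreover have "mon v * (comm_prod (a @ [i, j] @ b) + comm_prod (a @ [j, i] @ b)) \<in> W"
      by (intro M3 M3_left comm_prod_swap)
    ultimately have "mon v * (comm_prod (a @ [i, j] @ b) + comm_prod (a @ [j, i] @ b))
      - mon v * comm_prod (a @ [i, j] @ b) \<in> W"
      by blast
    then show "mon v * comm_prod (a @ [j, i] @ b) \<in> W"
      by (simp add: distrib_left)
  qed
  have avoiding: "mon v * comm_prod s' \<in> W"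
    if len: "length v = length w" and deg: "\<And>i. count_list v i + count_list s' i = m i"
      and disj: "distinct s' \<longrightarrow> set s' \<inter> Z = {}" for v s'
  proof (cases "distinct s'")
    case False
    then obtain a y b c where "s' = a @ [y] @ b @ [y] @ c"
      using not_distinct_decomp by blast
    then have "mset (y # y # a @ b @ c) = mset s'"
      by simp
    then show ?thesis
      by (rule permute) (simp add: commutator_def fa.subspace_0[OF W])
  next
    case True
    let ?S = "ordered_word r (\<lambda>i. of_bool (i \<in> set s'))"
    let ?V = "ordered_word r (\<lambda>i. m i - of_bool (i \<in> set s'))"
    show ?thesis
    proof (cases "even (length s')")
      case True
      then have "basis_element r m (set s') \<in> W"
        using \<open>distinct s'\<close> disj by (intro basis) (simp_all add: distinct_card)
      then have "mon ?V * comm_prod s' \<in> W"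
        unfolding basis_element_def
        by (rule permute[rotated]) (simp add: mset_eq_iff_count_list count_list_distinct \<open>distinct s'\<close>)
      moreover have "mon ?V * comm_prod s' - mon v * comm_prod s' \<in> W"
      proof (rule reorder[OF _ len deg])
        have "count_list v i = m i - of_bool (i \<in> set s')" for i
          using deg[of i] by (simp add: count_list_distinct \<open>distinct s'\<close>)
        then show "mset v = mset ?V"
          by (simp add: mset_eq_iff_count_list)
      qed
      ultimately have "mon ?V * comm_prod s' - (mon ?V * comm_prod s' - mon v * comm_prod s') \<in> W"
        by blast
      then show ?thesis
        by simp
    qed (simp add: comm_prod_odd fa.subspace_0[OF W])
  qed
  show ?case
  proof (cases "distinct s \<longrightarrow> set s \<inter> Z = {}")
    case True
    then show ?thesis
      using less.prems by (intro avoiding) auto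
  next
    case False
    then obtain i where i: "Z = {i}" "of_nat (m i) \<noteq> (0 :: 'k)" "i \<in> set s" and dist: "distinct s"
      using Z by auto
    show ?thesis
    proof (cases "remove1 i s")
      case Nil
      then have "length s = 1"
        using length_remove1[of i s] i(3) by (cases s) auto
      then show ?thesis
        by (simp add: comm_prod_odd fa.subspace_0[OF W])
    next
      case (Cons t T)
      let ?y = "mon w * comm_prod (t # i # T)"
      let ?v = "i # w"
      let ?del = "\<lambda>k. take k ?v @ drop (Suc k) ?v"
      let ?term = "\<lambda>k. mon (?del k) * comm_prod (t # ?v ! k # T)"
      have s: "mset (t # i # T) = mset s"
        using i(3) Cons by (metis add_mset_commute in_set_conv_decomp mset.simps(2) mset_remove1 insert_DiffM set_mset_mset)
      then have dist': "distinct (t # i # T)"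
        using dist mset_eq_imp_distinct_iff by blast
      have deg: "count_list w k + count_list (t # i # T) k = m k" for k
        using less.prems[of k] s by (metis mset_eq_iff_count_list)
      have del: "mset (?v ! k # ?del k) = mset ?v" if "k < length ?v" for k
        using that by (metis append_take_drop_id Cons_nth_drop_Suc mset.simps(2) mset_append union_mset_add_mset_right)
      have diff: "?term k - (if ?v ! k = i then ?y else 0) \<in> W" if k: "k < length ?v" for k
      proof (cases "?v ! k = i")
        case True
        then have "mset w = mset (?del k)"
          using del[OF k] by simp
        then show ?thesis
          using reorder[of w "?del k" "t # i # T"] deg True by simp
      next
        case False
        have "?term k \<in> W"
        proof (rule avoiding)
          show "length (?del k) = length w"
            using arg_cong[OF del[OF k], of size] by simp
          show "count_list (?del k) l + count_list (t # ?v ! k # T) l = m l" for l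
            using arg_cong[OF del[OF k], of "\<lambda>M. count M l"] deg[of l] by (auto simp: count_mset split: if_splits)
          show "distinct (t # ?v ! k # T) \<longrightarrow> set (t # ?v ! k # T) \<inter> Z = {}"
            using False dist' i(1) by auto
        qed
        with False show ?thesis
          by simp
      qed
      \<comment> \<open>This is the only use of \<open>L\<^sub>2\<close>: an exact form.\<close>
      have "commutator (mon [t]) (mon ?v * comm_prod T) \<in> W"
        using commutator_B1bar_kernel K by blast
      then have "commutator (mon [t]) (mon ?v * comm_prod T)
          - (commutator (mon [t]) (mon ?v * comm_prod T) - (\<Sum>k<length ?v. ?term k)) \<in> W"
        using M3[OF commutator_expand] by blast
      then have "(\<Sum>k<length ?v. ?term k) \<in> W"
        by (simp only: diff_diff_eq2 add_diff_cancel_left')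
      moreover have "(\<Sum>k<length ?v. ?term k - (if ?v ! k = i then ?y else 0)) \<in> W"
        using diff by (intro fa.subspace_sum[OF W]) auto
      ultimately have "(\<Sum>k<length ?v. ?term k)
          - (\<Sum>k<length ?v. ?term k - (if ?v ! k = i then ?y else 0)) \<in> W"
        by blast
      then have "(\<Sum>k<length ?v. if ?v ! k = i then ?y else 0) \<in> W"
        by (simp only: sum_subtractf diff_diff_eq2 add_diff_cancel_left')
      then have "fa_scale (of_nat (count_list ?v i)) ?y \<in> W"
        unfolding sum_positions .
      moreover have "count_list ?v i = m i"
        using deg[of i] dist' by (simp add: count_list_0_iff)
      ultimately have "fa_scale (inverse (of_nat (m i))) (fa_scale (of_nat (m i)) ?y) \<in> W"
        by (metis fa.subspace_scale[OF W])
      then have "?y \<in> W"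
        using i(2) by (simp add: fa.scale_scale)
      then show ?thesis
        using permute[OF s] by blast
    qed
  qed
qed

section \<open>Symbols of words in a Grassmann algebra\<close>

text \<open>
  The odd elements \<open>\<omega> i\<close> play the role of the logarithmic forms \<open>dx\<^sub>i / x\<^sub>i\<close>. Besides the
  anticommutation the squares must vanish, which is a separate requirement in characteristic two.
  The injection \<open>r\<close> orders the letters.
\<close>

locale grassmann_generators =
  fixes \<omega> :: "'x \<Rightarrow> 'r::ring_1" and r :: "'x \<Rightarrow> nat"
  assumes square_zero: "\<omega> i * \<omega> i = 0"
    and anticommute: "\<omega> i * \<omega> j = - (\<omega> j * \<omega> i)"
    and inj_r: "inj r"
begin

text \<open>
  The logarithmic derivative \<open>d(x\<^sup>w) / x\<^sup>w\<close> of a word: if \<open>w\<close> has multidegree \<open>m\<close>, then \<open>\<eta> w\<close> is the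
  sum of the \<open>m\<^sub>i \<omega>\<^sub>i\<close>, and the de Rham differential acts on multidegree \<open>m\<close> as multiplication by it.
\<close>

definition \<eta> :: "'x list \<Rightarrow> 'r" where
  "\<eta> w = (\<Sum>i\<leftarrow>w. \<omega> i)"

text \<open>
  Modulo \<open>M\<^sub>3\<close> a word is its ordered rearrangement, written as a monomial \<open>x\<^sup>m\<close>, times an even form;
  \<open>symb w\<close> is that form. To put a new first letter \<open>i\<close> in its place, it has to be moved past every
  later letter \<open>j\<close> with \<open>r j < r i\<close>, and each exchange contributes the commutator
  \<open>[x\<^sub>i, x\<^sub>j] = x\<^sub>i x\<^sub>j \<omega>\<^sub>i \<omega>\<^sub>j\<close>. A symmetric choice of the symbol would need the factor \<open>1/2\<close>;
  the ordered one makes sense over every field.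
\<close>

primrec symb :: "'x list \<Rightarrow> 'r" where
  "symb [] = 1"
| "symb (i # w) = (1 + \<omega> i * \<eta> (filter (\<lambda>j. r j < r i) w)) * symb w"

lemma eta_simps [simp]:
  "\<eta> [] = 0" "\<eta> (i # w) = \<omega> i + \<eta> w" "\<eta> (u @ v) = \<eta> u + \<eta> v"
  by (simp_all add: \<eta>_def)

lemma eta_eq_sum:
  assumes "finite A" "set v \<subseteq> A"
  shows "\<eta> v = (\<Sum>i\<in>A. of_nat (count_list v i) * \<omega> i)"
  using assms(2)
proof (induction v)
  case (Cons j v)
  have "of_nat (count_list (j # v) i) * \<omega> i
      = (if i = j then \<omega> j else 0) + of_nat (count_list v i) * \<omega> i" for i
    by (simp add: distrib_right add.commute)
  with Cons assms(1) show ?case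
    by (simp only: sum.distrib) simp
qed simp

lemma omega_eta: "\<omega> i * \<eta> w = - (\<eta> w * \<omega> i)"
  by (induction w) (simp_all add: algebra_simps anticommute[of i])

lemma eta_eta: "\<eta> v * \<eta> w = - (\<eta> w * \<eta> v)"
  by (induction v) (simp_all add: algebra_simps omega_eta)

lemma eta_square_zero: "\<eta> w * \<eta> w = 0"
  by (induction w) (simp_all add: algebra_simps omega_eta square_zero)

lemma omega_commute_pair: "\<omega> i * \<omega> j * \<omega> k = \<omega> k * (\<omega> i * \<omega> j)"
proof -
  have "\<omega> i * \<omega> j * \<omega> k = - (\<omega> i * \<omega> k * \<omega> j)"
    using anticommute[of j k] by (simp add: mult.assoc)
  also have "\<omega> i * \<omega> k = - (\<omega> k * \<omega> i)"
    by (rule anticommute)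
  finally show ?thesis
    by (simp add: mult.assoc)
qed

lemma omega_commute_omega_eta: "\<omega> i * \<eta> w * \<omega> k = \<omega> k * (\<omega> i * \<eta> w)"
  by (induction w) (simp_all add: distrib_left distrib_right omega_commute_pair)

lemma eta_commute_omega_eta: "\<omega> i * \<eta> w * \<eta> v = \<eta> v * (\<omega> i * \<eta> w)"
  by (induction v) (simp_all add: distrib_left distrib_right omega_commute_omega_eta)

lemma omega_eta_commute: "\<omega> i * \<eta> v * (\<omega> j * \<eta> w) = \<omega> j * \<eta> w * (\<omega> i * \<eta> v)"
proof -
  have "\<omega> i * \<eta> v * (\<omega> j * \<eta> w) = \<omega> i * \<eta> v * \<omega> j * \<eta> w"
    by (simp only: mult.assoc)
  also have "\<omega> i * \<eta> v * \<omega> j = \<omega> j * (\<omega> i * \<eta> v)"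
    by (rule omega_commute_omega_eta)
  also have "\<omega> j * (\<omega> i * \<eta> v) * \<eta> w = \<omega> j * (\<omega> i * \<eta> v * \<eta> w)"
    by (simp only: mult.assoc)
  also have "\<omega> i * \<eta> v * \<eta> w = \<eta> w * (\<omega> i * \<eta> v)"
    by (rule eta_commute_omega_eta)
  finally show ?thesis
    by (simp only: mult.assoc)
qed

lemma omega_mult_omega_eta: "\<omega> i * (\<omega> i * e) = 0"
  by (simp add: square_zero flip: mult.assoc)

lemma omega_eta_mult_omega: "\<omega> i * \<eta> w * (\<omega> i * e) = 0"
proof -
  have "\<omega> i * \<eta> w * \<omega> i = 0"
    by (simp add: omega_commute_omega_eta omega_mult_omega_eta)
  then show ?thesis
    by (simp flip: mult.assoc)
qed

lemma eta_mult_eta: "\<eta> v * (\<eta> v * e) = 0"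
  by (simp add: eta_square_zero flip: mult.assoc)

text \<open>
  The symbol is even, hence it commutes with the odd elements.
\<close>

lemma eta_commute_symb: "symb w * \<eta> v = \<eta> v * symb w"
proof (induction w)
  case (Cons i w)
  let ?e = "1 + \<omega> i * \<eta> (filter (\<lambda>j. r j < r i) w)"
  have "symb (i # w) * \<eta> v = ?e * \<eta> v * symb w"
    by (simp add: mult.assoc Cons.IH)
  also have "?e * \<eta> v = \<eta> v * ?e"
    by (simp only: distrib_left distrib_right eta_commute_omega_eta) simp
  finally show ?case
    by (simp add: mult.assoc)
qed simp

lemma omega_commute_symb: "symb w * \<omega> i = \<omega> i * symb w"
  using eta_commute_symb[of w "[i]"] by simp

lemma eta_perm: "mset v = mset w \<Longrightarrow> \<eta> v = \<eta> w"
  by (metis \<eta>_def mset_map sum_mset_sum_list)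

text \<open>
  A common prefix sees only the multiset of the letters behind it.
\<close>

lemma symb_append_cong:
  assumes "mset v = mset w" and "symb v = symb w * e"
  shows "symb (s @ v) = symb (s @ w) * e"
proof (induction s)
  case (Cons k s)
  have "\<eta> (filter (\<lambda>j. r j < r k) (s @ v)) = \<eta> (filter (\<lambda>j. r j < r k) (s @ w))"
    by (rule eta_perm) (simp add: assms(1))
  then show ?case
    using Cons.IH by (simp add: mult.assoc)
qed (use assms in simp)

text \<open>
  Only the letter with the larger rank sees the other one. The second equation follows from the
  first because \<open>\<omega> i * \<omega> j\<close> has square zero, so that \<open>1 + \<omega> i * \<omega> j\<close> and \<open>1 + \<omega> j * \<omega> i\<close> are inverse
  to each other.
\<close>

lemma symb_swap_less:
  assumes "r j < r i"
  shows "symb (i # j # t) = symb (j # i # t) * (1 + \<omega> i * \<omega> j)"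
    and "symb (j # i # t) = symb (i # j # t) * (1 + \<omega> j * \<omega> i)"
proof -
  define a where "a = \<omega> i * \<eta> (filter (\<lambda>k. r k < r i) t)"
  define b where "b = \<omega> j * \<eta> (filter (\<lambda>k. r k < r j) t)"
  have ab: "a * b = b * a"
    unfolding a_def b_def by (rule omega_eta_commute)
  have comm_a: "\<omega> i * \<omega> j * a = a * (\<omega> i * \<omega> j)"
    and comm_b: "\<omega> i * \<omega> j * b = b * (\<omega> i * \<omega> j)"
    unfolding a_def b_def using omega_eta_commute[of i "[j]"] by simp_all
  have comm_t: "symb t * (\<omega> i * \<omega> j) = \<omega> i * \<omega> j * symb t"
    using omega_commute_symb[of t i] omega_commute_symb[of t j] by (metis mult.assoc)
  have ij: "symb (i # j # t) = (1 + \<omega> i * \<omega> j + a) * ((1 + b) * symb t)"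
    using assms by (simp add: a_def b_def algebra_simps)
  have ji: "symb (j # i # t) = (1 + b) * ((1 + a) * symb t)"
    using assms by (simp add: a_def b_def algebra_simps)
  have qa: "\<omega> i * \<omega> j * a = 0"
    unfolding comm_a by (simp add: a_def omega_eta_mult_omega)
  have qq: "\<omega> i * \<omega> j * (\<omega> i * \<omega> j) = 0"
    using omega_eta_mult_omega[of i "[j]" "\<omega> j"] by simp
  have "symb (j # i # t) * (1 + \<omega> i * \<omega> j) = (1 + b) * ((1 + a) * ((1 + \<omega> i * \<omega> j) * symb t))"
    by (simp add: ji mult.assoc distrib_left distrib_right comm_t del: symb.simps)
  also have "(1 + a) * ((1 + \<omega> i * \<omega> j) * symb t) = (1 + \<omega> i * \<omega> j + a) * symb t"
    using comm_a qa by (simp add: distrib_left distrib_right add_ac flip: mult.assoc)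
  also have "(1 + b) * ((1 + \<omega> i * \<omega> j + a) * symb t) = (1 + \<omega> i * \<omega> j + a) * ((1 + b) * symb t)"
    using comm_b ab by (simp add: distrib_left distrib_right add_ac flip: mult.assoc)
  finally show 1: "symb (i # j # t) = symb (j # i # t) * (1 + \<omega> i * \<omega> j)"
    by (simp add: ij del: symb.simps)
  have "(1 + \<omega> i * \<omega> j) * (1 + \<omega> j * \<omega> i) = 1"
    using qq anticommute[of j i] by (simp add: distrib_left distrib_right right_diff_distrib)
  then show "symb (j # i # t) = symb (i # j # t) * (1 + \<omega> j * \<omega> i)"
    unfolding 1 by (simp add: mult.assoc del: symb.simps)
qed

lemma symb_swap_letters: "symb (i # j # t) = symb (j # i # t) * (1 + \<omega> i * \<omega> j)"
proof (cases "i = j")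
  case False
  then have "r i < r j \<or> r j < r i"
    using inj_r by (meson injD linorder_neqE_nat)
  then show ?thesis
    using symb_swap_less by blast
qed (simp add: square_zero)

lemma symb_move_letter: "symb (i # v @ t) = symb (v @ i # t) * (1 + \<omega> i * \<eta> v)"
proof (induction v)
  case (Cons j v)
  have "symb (i # (j # v) @ t) = symb (j # i # v @ t) * (1 + \<omega> i * \<omega> j)"
    using symb_swap_letters[of i j "v @ t"] by simp
  also have "symb (j # i # v @ t) = symb (j # v @ i # t) * (1 + \<omega> i * \<eta> v)"
    using symb_append_cong[of "i # v @ t" "v @ i # t" "1 + \<omega> i * \<eta> v" "[j]"] Cons.IH
    by (simp del: symb.simps)
  also have "symb (j # v @ i # t) * (1 + \<omega> i * \<eta> v) * (1 + \<omega> i * \<omega> j)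
      = symb (j # v @ i # t) * ((1 + \<omega> i * \<eta> v) * (1 + \<omega> i * \<omega> j))"
    by (simp only: mult.assoc)
  also have "(1 + \<omega> i * \<eta> v) * (1 + \<omega> i * \<omega> j) = 1 + \<omega> i * \<eta> (j # v)"
  proof -
    have "\<omega> i * \<eta> v * (\<omega> i * \<omega> j) = 0"
      by (rule omega_eta_mult_omega)
    then show ?thesis
      by (simp add: distrib_left distrib_right add_ac)
  qed
  finally show ?case
    by simp
qed simp

text \<open>
  The exchange factor is \<open>exp (\<eta> u * \<eta> v)\<close>, the product over all pairs of letters; the exponential
  series stops after the linear term because \<open>\<eta> v\<close> has square zero.
\<close>

lemma symb_swap: "symb (s @ u @ v @ t) = symb (s @ v @ u @ t) * (1 + \<eta> u * \<eta> v)"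
proof -
  have "symb (u @ v @ t) = symb (v @ u @ t) * (1 + \<eta> u * \<eta> v)" for t
  proof (induction u)
    case (Cons i u)
    have "symb ((i # u) @ v @ t) = symb (i # v @ u @ t) * (1 + \<eta> u * \<eta> v)"
      using symb_append_cong[of "u @ v @ t" "v @ u @ t" _ "[i]"] Cons.IH by (simp del: symb.simps)
    also have "symb (i # v @ u @ t) = symb (v @ i # u @ t) * (1 + \<omega> i * \<eta> v)"
      by (rule symb_move_letter)
    also have "\<dots> * (1 + \<eta> u * \<eta> v) = symb (v @ i # u @ t) * ((1 + \<omega> i * \<eta> v) * (1 + \<eta> u * \<eta> v))"
      by (simp only: mult.assoc)
    also have "(1 + \<omega> i * \<eta> v) * (1 + \<eta> u * \<eta> v) = 1 + \<eta> (i # u) * \<eta> v"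
    proof -
      have "\<omega> i * \<eta> v * (\<eta> u * \<eta> v) = \<eta> u * (\<omega> i * \<eta> v) * \<eta> v"
        using eta_commute_omega_eta[of i v u] by (simp only: flip: mult.assoc)
      also have "\<dots> = 0"
        by (simp add: mult.assoc eta_square_zero)
      finally show ?thesis
        by (simp add: distrib_left distrib_right add_ac)
    qed
    finally show ?case
      by simp
  qed simp
  then show ?thesis
    by (intro symb_append_cong) simp_all
qed

lemma symb_commutator:
  "symb (s @ u @ v @ t) - symb (s @ v @ u @ t) = symb (s @ v @ u @ t) * (\<eta> u * \<eta> v)"
  unfolding symb_swap[of s u v t] by (simp add: distrib_left)

text \<open>
  The commutator of \<open>b\<close> and \<open>c\<close> produces \<open>\<eta> b * \<eta> c\<close>, and a further commutator with \<open>a\<close> produces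
  \<open>\<eta> a * (\<eta> b + \<eta> c)\<close>, whose product with it is zero. So the symbol is defined on \<open>A / M\<^sub>3\<close>.
\<close>

lemma symb_double_commutator:
  "(symb (z @ a @ b @ c) - symb (z @ a @ c @ b)) - (symb (z @ b @ c @ a) - symb (z @ c @ b @ a)) = 0"
proof -
  have "symb (z @ a @ c @ b) - symb (z @ c @ b @ a) = symb (z @ c @ b @ a) * (\<eta> a * (\<eta> c + \<eta> b))"
    using symb_commutator[of z a "c @ b" "[]"] by simp
  then have "(symb (z @ a @ c @ b) - symb (z @ c @ b @ a)) * (\<eta> b * \<eta> c)
      = symb (z @ c @ b @ a) * \<eta> a * ((\<eta> c + \<eta> b) * (\<eta> b * \<eta> c))"
    by (simp only: mult.assoc)
  also have "(\<eta> c + \<eta> b) * (\<eta> b * \<eta> c) = 0"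
  proof -
    have "\<eta> c * (\<eta> b * \<eta> c) = 0"
      unfolding eta_eta[of b c] by (simp add: eta_mult_eta)
    then show ?thesis
      by (simp add: distrib_right eta_mult_eta)
  qed
  finally have "(symb (z @ a @ c @ b) - symb (z @ c @ b @ a)) * (\<eta> b * \<eta> c) = 0"
    by simp
  moreover have "symb (z @ a @ b @ c) - symb (z @ a @ c @ b) = symb (z @ a @ c @ b) * (\<eta> b * \<eta> c)"
    using symb_commutator[of "z @ a" b c "[]"] by simp
  moreover have "symb (z @ b @ c @ a) - symb (z @ c @ b @ a) = symb (z @ c @ b @ a) * (\<eta> b * \<eta> c)"
    by (rule symb_commutator)
  ultimately show ?thesis
    by (simp add: left_diff_distrib)
qed

text \<open>
  Commutators have exact symbols: multiples of \<open>\<eta>\<close> of the total multidegree.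
\<close>

lemma symb_cyclic_commutator:
  "symb (u @ v) - symb (v @ u) = symb (v @ u) * \<eta> u * \<eta> (u @ v)"
  using symb_commutator[of "[]" u v "[]"]
  by (simp add: mult.assoc distrib_left eta_square_zero)

text \<open>
  Every contribution of the letter \<open>i\<close> to the symbol contains \<open>\<omega> i\<close>, which squares to zero.
\<close>

lemma symb_absorb: "symb (w @ i # t) * \<omega> i = symb (w @ t) * \<omega> i"
proof (induction w)
  case Nil
  have "symb (i # t) * \<omega> i = (1 + \<omega> i * \<eta> (filter (\<lambda>j. r j < r i) t)) * \<omega> i * symb t"
    by (simp add: mult.assoc omega_commute_symb)
  also have "(1 + \<omega> i * \<eta> (filter (\<lambda>j. r j < r i) t)) * \<omega> i = \<omega> i"
    by (simp add: distrib_right omega_commute_omega_eta square_zero flip: mult.assoc)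
  finally show ?case
    by (simp add: omega_commute_symb)
next
  case (Cons k w)
  let ?f = "filter (\<lambda>j. r j < r k)"
  have "\<omega> k * \<eta> (?f (w @ i # t)) * \<omega> i = \<omega> k * \<eta> (?f (w @ t)) * \<omega> i"
    by (simp add: distrib_left distrib_right mult.assoc square_zero)
  then have eq: "(1 + \<omega> k * \<eta> (?f (w @ i # t))) * \<omega> i = (1 + \<omega> k * \<eta> (?f (w @ t))) * \<omega> i"
    by (simp only: distrib_right)
  have "symb ((k # w) @ i # t) * \<omega> i = (1 + \<omega> k * \<eta> (?f (w @ i # t))) * (symb (w @ i # t) * \<omega> i)"
    by (simp only: append_Cons symb.simps mult.assoc)
  also have "\<dots> = (1 + \<omega> k * \<eta> (?f (w @ i # t))) * \<omega> i * symb (w @ t)"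
    unfolding Cons.IH by (simp only: omega_commute_symb mult.assoc)
  also have "\<dots> = (1 + \<omega> k * \<eta> (?f (w @ t))) * (symb (w @ t) * \<omega> i)"
    by (simp only: eq omega_commute_symb mult.assoc)
  also have "\<dots> = symb ((k # w) @ t) * \<omega> i"
    by (simp only: append_Cons symb.simps mult.assoc)
  finally show ?case .
qed

lemma symb_generator_commutator:
  "symb (w @ [i, j]) - symb (w @ [j, i]) = symb w * (\<omega> i * \<omega> j)"
proof -
  have "symb (w @ [i, j]) - symb (w @ [j, i]) = symb (w @ [j, i]) * \<omega> i * \<omega> j"
    using symb_commutator[of w "[i]" "[j]" "[]"] by (simp add: mult.assoc)
  also have "\<dots> = symb (w @ [j]) * \<omega> i * \<omega> j"
    using symb_absorb[of "w @ [j]" i "[]"] by simp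
  also have "\<dots> = - (symb (w @ [j]) * \<omega> j * \<omega> i)"
    using anticommute[of i j] by (simp add: mult.assoc)
  also have "\<dots> = symb w * (\<omega> i * \<omega> j)"
    using symb_absorb[of w j "[]"] anticommute[of i j] by (simp add: mult.assoc)
  finally show ?thesis .
qed

lemma symb_sorted: "sorted (map r w) \<Longrightarrow> symb w = 1"
proof (induction w)
  case (Cons i w)
  then have "filter (\<lambda>j. r j < r i) w = []"
    by (auto simp: filter_empty_conv)
  with Cons show ?case
    by simp
qed simp

end

section \<open>The exterior algebra as an algebra of operators\<close>

text \<open>
  The exterior algebra is realized by operators. Additive endomorphisms of the space of functions on
  the index subsets form a ring without further work, so associativity and distributivity of the
  wedge product come for free.
\<close>

typedef (overloaded) ('a, 'k) fun_endo =
  "{f :: ('a \<Rightarrow> 'k::field) \<Rightarrow> 'a \<Rightarrow> 'k. \<forall>g h. f (g + h) = f g + f h}"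
  morphisms endo_apply Abs_fun_endo
  by (rule exI[of _ id]) simp

setup_lifting type_definition_fun_endo

instantiation fun_endo :: (type, field) ring_1
begin

lift_definition zero_fun_endo :: "('a, 'b) fun_endo" is "\<lambda>_. 0" by simp
lift_definition one_fun_endo :: "('a, 'b) fun_endo" is "\<lambda>g. g" by simp
lift_definition plus_fun_endo :: "('a, 'b) fun_endo \<Rightarrow> ('a, 'b) fun_endo \<Rightarrow> ('a, 'b) fun_endo"
  is "\<lambda>e f g. e g + f g" by (simp add: algebra_simps)
lift_definition uminus_fun_endo :: "('a, 'b) fun_endo \<Rightarrow> ('a, 'b) fun_endo"
  is "\<lambda>e g. - e g" by simp
lift_definition minus_fun_endo :: "('a, 'b) fun_endo \<Rightarrow> ('a, 'b) fun_endo \<Rightarrow> ('a, 'b) fun_endo"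
  is "\<lambda>e f g. e g - f g" by (simp add: algebra_simps)
lift_definition times_fun_endo :: "('a, 'b) fun_endo \<Rightarrow> ('a, 'b) fun_endo \<Rightarrow> ('a, 'b) fun_endo"
  is "\<lambda>e f g. e (f g)" by simp

instance
proof
  have "(\<lambda>_. 0) \<noteq> (\<lambda>g :: 'a \<Rightarrow> 'b. g)"
  proof
    assume "(\<lambda>_. 0) = (\<lambda>g :: 'a \<Rightarrow> 'b. g)"
    from fun_cong[OF fun_cong[OF this, of "\<lambda>_. 1"]] show False
      by simp
  qed
  then show "(0 :: ('a, 'b) fun_endo) \<noteq> 1"
    by transfer
qed (transfer; simp add: fun_eq_iff algebra_simps)+

end

lemmas endo_apply_simps [simp] = zero_fun_endo.rep_eq one_fun_endo.rep_eq plus_fun_endo.rep_eq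
  uminus_fun_endo.rep_eq minus_fun_endo.rep_eq times_fun_endo.rep_eq

lemma endo_apply_of_nat: "endo_apply (of_nat n) g a = of_nat n * g a"
  by (induction n) (simp_all add: algebra_simps)

text \<open>
  Left multiplication by the generator \<open>\<omega>\<^sub>i\<close>, where \<open>g S\<close> is the coefficient of the monomial
  \<open>\<omega>\<^sub>S\<close> with factors in increasing rank; the sign counts the factors that \<open>\<omega>\<^sub>i\<close> has to pass.
\<close>

lift_definition wedge :: "('x \<Rightarrow> nat) \<Rightarrow> 'x \<Rightarrow> ('x set, 'k::field) fun_endo" is
  "\<lambda>r i g S. if i \<in> S then (- 1) ^ card {j \<in> S. r j < r i} * g (S - {i}) else 0"
  by (simp add: fun_eq_iff algebra_simps)

lemma wedge_apply:
  "endo_apply (wedge r i) g S =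
     (if i \<in> S then (- 1) ^ card {j \<in> S. r j < r i} * g (S - {i}) else 0)"
  by transfer simp

lemma wedge_anticommute_less:
  assumes "inj r" "r i < r j"
  shows "wedge r i * wedge r j = - (wedge r j * wedge r i :: ('x set, 'k::field) fun_endo)"
proof -
  have "endo_apply (wedge r i * wedge r j) g S = endo_apply (- (wedge r j * wedge r i)) g S"
    for g :: "'x set \<Rightarrow> 'k" and S
  proof (cases "i \<in> S \<and> j \<in> S")
    case True
    let ?A = "{k \<in> S - {i}. r k < r j}"
    have "finite (r -` {..<r j})"
      using assms(1) by (intro finite_vimageI) auto
    then have fin: "finite ?A"
      by (rule rev_finite_subset) auto
    have "{k \<in> S. r k < r j} = insert i ?A"
      using True assms(2) by auto
    then have j: "card {k \<in> S. r k < r j} = Suc (card ?A)"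
      using fin by simp
    have i: "{k \<in> S - {j}. r k < r i} = {k \<in> S. r k < r i}"
      using assms(2) by auto
    have "S - {i} - {j} = S - {j} - {i}"
      by auto
    with True i j assms show ?thesis
      by (simp add: wedge_apply)
  qed (use assms in \<open>auto simp: wedge_apply\<close>)
  then show ?thesis
    by (metis endo_apply_inject ext)
qed

lemma grassmann_generators_wedge:
  assumes "inj r"
  shows "grassmann_generators (wedge r :: 'x \<Rightarrow> ('x set, 'k::field) fun_endo) r"
proof
  show sq: "wedge r i * wedge r i = (0 :: ('x set, 'k) fun_endo)" for i
    by (rule endo_apply_inject[THEN iffD1]) (simp add: fun_eq_iff wedge_apply)
  show "wedge r i * wedge r j = - (wedge r j * wedge r i :: ('x set, 'k) fun_endo)" for i j
  proof (cases "i = j")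
    case False
    then have "r i < r j \<or> r j < r i"
      using assms by (meson injD linorder_neqE_nat)
    then show ?thesis
      using wedge_anticommute_less[OF assms] by (metis minus_minus)
  qed (simp add: sq)
qed (rule assms)

text \<open>
  The unit \<open>1\<close> of the exterior algebra, on which the operators act.
\<close>

definition vac :: "'x set \<Rightarrow> 'k::field" where
  "vac S = (if S = {} then 1 else 0)"

lemma wedge_monomial_eq_0:
  "S \<noteq> set s \<Longrightarrow> endo_apply (\<Prod>i\<leftarrow>s. wedge r i) vac S = 0"
proof (induction s arbitrary: S)
  case (Cons i s)
  then show ?case
    by (cases "S - {i} = set s") (auto simp: wedge_apply)
qed (simp add: vac_def)

lemma wedge_monomial_neq_0:
  "distinct s \<Longrightarrow> endo_apply (\<Prod>i\<leftarrow>s. wedge r i) (vac :: _ \<Rightarrow> 'k::field) (set s) \<noteq> 0"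
  by (induction s) (simp_all add: wedge_apply vac_def)

lemma additive_endo_apply: "additive (\<lambda>e. endo_apply (d * e) g a)"
  by standard (simp add: distrib_left)

text \<open>
  The coefficient at a set \<open>S\<close> that contains \<open>i\<close>, while \<open>\<omega>\<^sub>s\<close> does not, isolates the summand of
  \<open>\<eta> v\<close> that belongs to \<open>i\<close>. This makes the functionals below dual to the basis elements.
\<close>

lemma wedge_eta_monomial:
  assumes "inj r" "i \<notin> set s" "i \<in> S"
  shows "endo_apply (grassmann_generators.\<eta> (wedge r) v * (\<Prod>j\<leftarrow>s. wedge r j)) vac S
    = of_nat (count_list v i) * endo_apply (\<Prod>j\<leftarrow>i # s. wedge r j) (vac :: _ \<Rightarrow> 'k::field) S"
proof -
  interpret grassmann_generators "wedge r :: _ \<Rightarrow> (_, 'k) fun_endo" r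
    by (rule grassmann_generators_wedge) (rule assms)
  show ?thesis
  proof (induction v)
    case (Cons j v)
    have "endo_apply (wedge r j * (\<Prod>j\<leftarrow>s. wedge r j)) vac S
      = (if j = i then endo_apply (\<Prod>j\<leftarrow>i # s. wedge r j) (vac :: _ \<Rightarrow> 'k) S else 0)"
      using wedge_monomial_eq_0[of S "j # s" r] assms by auto
    with Cons.IH show ?case
      by (simp add: distrib_right)
  qed simp
qed

section \<open>Functionals that vanish on the kernel\<close>

lemma subspace_vimage_mult:
  assumes "fa.subspace P"
  shows "fa.subspace {f. a * f * b \<in> P}"
  by (rule fa.subspaceI)
    (simp_all add: distrib_left distrib_right fa_scale_left fa_scale_right
      fa.subspace_add fa.subspace_scale fa.subspace_0 assms)

lemma subspace_vimage_commutator: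
  assumes "fa.subspace P"
  shows "fa.subspace {a. z * commutator a y \<in> P}" "fa.subspace {y. z * commutator a y \<in> P}"
proof -
  have add: "z * commutator (a + b) y = z * commutator a y + z * commutator b y"
    "z * commutator y (a + b) = z * commutator y a + z * commutator y b" for a b y
    by (simp_all add: commutator_def algebra_simps)
  have scale: "z * commutator (fa_scale c a) y = fa_scale c (z * commutator a y)"
    "z * commutator y (fa_scale c a) = fa_scale c (z * commutator y a)" for a c y
    by (simp_all add: commutator_def fa_scale_left fa_scale_right right_diff_distrib fa.scale_right_diff_distrib)
  have zero: "z * commutator 0 y = 0" "z * commutator y 0 = 0" for y
    by (simp_all add: commutator_def)
  show "fa.subspace {a. z * commutator a y \<in> P}" "fa.subspace {y. z * commutator a y \<in> P}"
    by (rule fa.subspaceI; simp add: add scale zero fa.subspace_add fa.subspace_scale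
        fa.subspace_0 assms)+
qed

text \<open>
  Spans and arbitrary elements disappear from \<open>L\<^sub>2 + M\<^sub>3\<close> by multilinearity: it suffices to test
  commutators and double commutators of words.
\<close>

lemma B1bar_kernel_subset:
  assumes P: "fa.subspace P"
    and comm: "\<And>u v. mon (u @ v) - mon (v @ u) \<in> P"
    and double: "\<And>z a b d.
      (mon (z @ a @ b @ d) - mon (z @ a @ d @ b)) - (mon (z @ b @ d @ a) - mon (z @ d @ b @ a)) \<in> P"
  shows "B1bar_kernel fa_scale \<subseteq> P"
proof -
  note sub = subspace_vimage_commutator
  have "z * commutator (mon a) (commutator (mon b) (mon d)) \<in> P" for z a b d
  proof -
    have "z \<in> {z. 1 * z * commutator (mon a) (commutator (mon b) (mon d)) \<in> P}"
    proof (rule span_monomials[OF subspace_vimage_mult[OF P]])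
      show "mon w \<in> {z. 1 * z * commutator (mon a) (commutator (mon b) (mon d)) \<in> P}" for w
        using double[of w a b d] by (simp add: commutator_def mon_append algebra_simps)
    qed
    then show ?thesis by simp
  qed
  then have "1 * commutator (mon b) (mon d) \<in> {y. z * commutator (mon a) y \<in> P}" for z a b d
    by simp
  then have "d \<in> {d. 1 * commutator (mon b) d \<in> {y. z * commutator (mon a) y \<in> P}}" for z a b d
    by - (rule span_monomials[OF sub(2)[OF sub(2)[OF P]]], auto)
  then have "b \<in> {b. 1 * commutator b d \<in> {y. z * commutator (mon a) y \<in> P}}" for z a b d
    by - (rule span_monomials[OF sub(1)[OF sub(2)[OF P]]], auto)
  then have "a \<in> {a. z * commutator a (commutator b d) \<in> P}" for z a b d
    by - (rule span_monomials[OF sub(1)[OF P]], auto)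
  then have m3: "z * commutator a (commutator b d) \<in> P" for z a b d
    by blast
  have comm': "commutator a b \<in> P" for a b
  proof -
    have "1 * commutator (mon u) (mon v) \<in> P" for u v
      using comm[of u v] by (simp add: commutator_def mon_append)
    then have "b \<in> {b. 1 * commutator (mon u) b \<in> P}" for u
      by - (rule span_monomials[OF sub(2)[OF P]], auto)
    then have "a \<in> {a. 1 * commutator a b \<in> P}"
      by - (rule span_monomials[OF sub(1)[OF P]], auto)
    then show ?thesis by simp
  qed
  have "lower_central fa_scale 2 \<subseteq> P"
    unfolding lower_central_2_eq by (rule fa.span_minimal[OF _ P]) (use comm' in auto)
  moreover have "z * y \<in> P" if y: "y \<in> lower_central fa_scale 3" for y z
  proof -
    have "z * commutator a b \<in> P" if "b \<in> lower_central fa_scale 2" for a b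
    proof -
      have "lower_central fa_scale 2 \<subseteq> {b. z * commutator a b \<in> P}"
        unfolding lower_central_2_eq by (rule fa.span_minimal[OF _ sub(2)[OF P]]) (use m3 in auto)
      with that show ?thesis by auto
    qed
    then have "lower_central fa_scale 3 \<subseteq> {y. z * y * 1 \<in> P}"
      unfolding lower_central_3_eq by (intro fa.span_minimal[OF _ subspace_vimage_mult[OF P]]) auto
    with y show ?thesis by auto
  qed
  then have "M3 \<subseteq> P"
    unfolding lower_central_ideal_def by (intro fa.span_minimal[OF _ P]) auto
  ultimately show ?thesis
    unfolding B1bar_kernel_def by (auto intro: fa.subspace_add[OF P])
qed

lemma mon_comm_prod_Cons:
  "mon w * comm_prod (i # j # s) = mon (w @ [i, j]) * comm_prod s - mon (w @ [j, i]) * comm_prod s"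
  by (simp add: commutator_def mon_split[of w _ _ "[]", simplified] algebra_simps)

context grassmann_generators
begin

text \<open>
  Words of other multidegrees are sent to \<open>0\<close>, so that the functional can vanish on all of
  \<open>L\<^sub>2 + M\<^sub>3\<close>, although exactness of the symbols means something different in each multidegree.
\<close>

definition symbol_functional :: "('x \<Rightarrow> nat) \<Rightarrow> ('r \<Rightarrow> 'k::field) \<Rightarrow> 'x list \<Rightarrow> 'k" where
  "symbol_functional m A w = (if \<forall>i. count_list w i = m i then A (symb w) else 0)"

lemma symbol_functional_kernel:
  assumes A: "additive A"
    and vanish: "\<And>u v w. \<forall>i. count_list v i = m i \<Longrightarrow> A (symb w * \<eta> u * \<eta> v) = 0"
    and f: "f \<in> B1bar_kernel fa_scale"
  shows "lin_ext (symbol_functional m A) f = 0"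
proof -
  let ?c = "symbol_functional m A"
  have comm: "?c (u @ v) - ?c (v @ u) = 0" for u v
  proof -
    have "A (symb (u @ v)) - A (symb (v @ u)) = A (symb (v @ u) * \<eta> u * \<eta> (u @ v))"
      by (simp only: additive.diff[OF A, symmetric] symb_cyclic_commutator)
    then show ?thesis
      using vanish[of "u @ v" "v @ u" u] by (auto simp: symbol_functional_def add.commute)
  qed
  have double: "(?c (z @ a @ b @ d) - ?c (z @ a @ d @ b)) - (?c (z @ b @ d @ a) - ?c (z @ d @ b @ a)) = 0"
    for z a b d
    using symb_double_commutator[of z a b d] additive.zero[OF A]
    by (auto simp: symbol_functional_def add_ac simp flip: additive.diff[OF A])
  have "B1bar_kernel fa_scale \<subseteq> {f. lin_ext ?c f = 0}"
    by (rule B1bar_kernel_subset[OF subspace_lin_ext_kernel])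
      (simp_all only: mem_Collect_eq lin_ext_diff lin_ext_mon comm double)
  with f show ?thesis by auto
qed

text \<open>
  Expanded into words, the commutators of generators have the symbols \<open>\<omega>\<^sub>i \<omega>\<^sub>j\<close> one after the other.
\<close>

lemma symbol_functional_mon_comm_prod:
  assumes A: "additive A"
    and "even (length s)" and "\<And>i. count_list w i + count_list s i = m i"
  shows "lin_ext (symbol_functional m A) (mon w * comm_prod s) = A (symb w * (\<Prod>i\<leftarrow>s. \<omega> i))"
  using assms(2,3)
proof (induction s arbitrary: w rule: comm_prod.induct)
  case (3 i j s)
  have deg: "count_list (w @ [i, j]) k + count_list s k = m k"
    "count_list (w @ [j, i]) k + count_list s k = m k" for k
    using "3.prems"(2)[of k] by (auto split: if_splits)
  have "lin_ext (symbol_functional m A) (mon (w @ [i, j]) * comm_prod s)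
      = A (symb (w @ [i, j]) * (\<Prod>i\<leftarrow>s. \<omega> i))"
    "lin_ext (symbol_functional m A) (mon (w @ [j, i]) * comm_prod s)
      = A (symb (w @ [j, i]) * (\<Prod>i\<leftarrow>s. \<omega> i))"
    using "3.prems" deg by (auto intro!: "3.IH")
  then have "lin_ext (symbol_functional m A) (mon w * comm_prod (i # j # s))
      = A (symb (w @ [i, j]) * (\<Prod>i\<leftarrow>s. \<omega> i)) - A (symb (w @ [j, i]) * (\<Prod>i\<leftarrow>s. \<omega> i))"
    by (simp only: mon_comm_prod_Cons lin_ext_diff)
  also have "\<dots> = A ((symb (w @ [i, j]) - symb (w @ [j, i])) * (\<Prod>i\<leftarrow>s. \<omega> i))"
    by (simp only: additive.diff[OF A] left_diff_distrib)
  also have "\<dots> = A (symb w * (\<Prod>i\<leftarrow>i # j # s. \<omega> i))"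
    by (simp add: symb_generator_commutator mult.assoc)
  finally show ?case .
qed (auto simp: symbol_functional_def)

end

lemma subspace_fa_component: "fa.subspace (fa_component m)"
  by (rule fa.subspaceI)
    (auto simp: fa_component_def in_keys_iff lookup_fa_scale lookup_add)

lemma mon_comm_prod_in_component:
  assumes "\<And>i. count_list w i + count_list s i = m i"
  shows "mon w * comm_prod s \<in> fa_component m"
  using assms
proof (induction s arbitrary: w rule: comm_prod.induct)
  case (3 i j s)
  have deg: "count_list (w @ [i, j]) k + count_list s k = m k"
    "count_list (w @ [j, i]) k + count_list s k = m k" for k
    using "3.prems"(1)[of k] by (auto split: if_splits)
  show ?case
    unfolding mon_comm_prod_Cons
    by (intro fa.subspace_diff[OF subspace_fa_component] "3.IH" deg)
qed (auto simp: fa_component_def mon_def)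

lemma B1bar_class_eq_iff: "B1bar_class f = B1bar_class g \<longleftrightarrow> f - g \<in> B1bar_kernel fa_scale"
  by (simp add: B1bar.abs_eq_iff B1bar_rel_def)

text \<open>
  Dimension by duality: a spanning family for which there are dual functionals, up to nonzero
  factors, that vanish on the kernel.
\<close>

lemma dim_B1bar_component:
  fixes g :: "'i \<Rightarrow> ('x, 'k::field) free_algebra"
  assumes "finite I"
    and comp: "\<And>S. S \<in> I \<Longrightarrow> g S \<in> fa_component m"
    and span: "fa_component m \<subseteq> fa.span (B1bar_kernel fa_scale \<union> g ` I)"
    and kernel: "\<And>S f. S \<in> I \<Longrightarrow> f \<in> B1bar_kernel fa_scale \<Longrightarrow> lin_ext (c S) f = 0"
    and diag: "\<And>S. S \<in> I \<Longrightarrow> lin_ext (c S) (g S) \<noteq> 0"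
    and off: "\<And>S T. S \<in> I \<Longrightarrow> T \<in> I \<Longrightarrow> S \<noteq> T \<Longrightarrow> lin_ext (c S) (g T) = 0"
  shows "B1bar.dim (B1bar_component m :: ('x, 'k) B1bar set) = card I"
proof (rule B1bar.dim_unique)
  let ?B = "(\<lambda>S. B1bar_class (g S)) ` I"
  have eqD: "lin_ext (c S) f = lin_ext (c S) h" if "S \<in> I" "B1bar_class f = B1bar_class h" for S f h
    using kernel[OF that(1), of "f - h"] that(2) by (simp add: B1bar_class_eq_iff lin_ext_diff)
  show "?B \<subseteq> B1bar_component m"
    using comp by (auto simp: B1bar_component_def)
  show "card ?B = card I"
    using eqD diag off by (intro card_image inj_onI) metis
  show "B1bar.independent ?B"
    unfolding B1bar.dependent_def
  proof (clarify)
    fix S assume S: "S \<in> I" and dep: "B1bar_class (g S) \<in> B1bar.span (?B - {B1bar_class (g S)})"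
    let ?N = "B1bar_class ` {f. lin_ext (c S) f = 0}"
    have "B1bar.span (?B - {B1bar_class (g S)}) \<subseteq> ?N"
    proof (rule B1bar.span_minimal)
      show "?B - {B1bar_class (g S)} \<subseteq> ?N"
        using off[OF S] by auto
      show "B1bar.subspace ?N"
      proof (rule B1bar.subspaceI)
        show "0 \<in> ?N"
          by (rule image_eqI[of _ _ 0]) (simp_all add: zero_B1bar.abs_eq)
      next
        fix a b assume "a \<in> ?N" "b \<in> ?N"
        then obtain f h where "a = B1bar_class f" "lin_ext (c S) f = 0" "b = B1bar_class h" "lin_ext (c S) h = 0"
          by auto
        then show "a + b \<in> ?N"
          by (intro image_eqI[of _ _ "f + h"]) (simp_all add: plus_B1bar.abs_eq lin_ext_add)
      next
        fix k a assume "a \<in> ?N"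
        then obtain f where "a = B1bar_class f" "lin_ext (c S) f = 0"
          by auto
        then show "B1bar_scale k a \<in> ?N"
          by (intro image_eqI[of _ _ "fa_scale k f"]) (simp_all add: B1bar_scale.abs_eq lin_ext_scale)
      qed
    qed
    with dep obtain f where "B1bar_class (g S) = B1bar_class f" "lin_ext (c S) f = 0"
      by auto
    with eqD[OF S] diag[OF S] show False
      by metis
  qed
  show "B1bar_component m \<subseteq> B1bar.span ?B"
  proof -
    have "fa.span (B1bar_kernel fa_scale \<union> g ` I) \<subseteq> {f. B1bar_class f \<in> B1bar.span ?B}"
    proof (rule fa.span_minimal)
      show "fa.subspace {f. B1bar_class f \<in> B1bar.span ?B}"
        by (rule fa.subspaceI) (simp_all add: B1bar.span_zero B1bar.span_add B1bar.span_scale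
            flip: zero_B1bar.abs_eq plus_B1bar.abs_eq B1bar_scale.abs_eq)
      have "B1bar_class f = 0" if "f \<in> B1bar_kernel fa_scale" for f :: "('x, 'k) free_algebra"
        using that by (simp add: zero_B1bar.abs_eq B1bar_class_eq_iff)
      then show "B1bar_kernel fa_scale \<union> g ` I \<subseteq> {f. B1bar_class f \<in> B1bar.span ?B}"
        by (auto simp: B1bar.span_zero intro: B1bar.span_base)
    qed
    with span show ?thesis
      by (auto simp: B1bar_component_def)
  qed
qed

section \<open>The dimension of a component\<close>

text \<open>
  Removing a fixed element \<open>a\<close> is a bijection onto all subsets of \<open>A - {a}\<close>; parity decides whether
  \<open>a\<close> has to be put back.
\<close>

lemma card_even_subsets:
  assumes "finite A" "A \<noteq> {}"
  shows "card {S. S \<subseteq> A \<and> even (card S)} = 2 ^ (card A - 1)"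
proof -
  from assms obtain a where a: "a \<in> A" by auto
  have fin: "finite S" if "S \<subseteq> A" for S
    using that assms(1) finite_subset by blast
  have "bij_betw (\<lambda>S. S - {a}) {S. S \<subseteq> A \<and> even (card S)} (Pow (A - {a}))"
  proof (rule bij_betw_byWitness[where f' = "\<lambda>T. if even (card T) then T else insert a T"])
    show "\<forall>S\<in>{S. S \<subseteq> A \<and> even (card S)}. (if even (card (S - {a})) then S - {a} else insert a (S - {a})) = S"
    proof
      fix S assume S: "S \<in> {S. S \<subseteq> A \<and> even (card S)}"
      show "(if even (card (S - {a})) then S - {a} else insert a (S - {a})) = S"
      proof (cases "a \<in> S")
        case True
        then have "card S = Suc (card (S - {a}))"
          using S fin by (intro card.remove) auto
        moreover have "even (card S)"
          using S by simp
        ultimately have "odd (card (S - {a}))"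
          by simp
        with True show ?thesis
          by (simp add: insert_absorb)
      qed (use S in auto)
    qed
    show "(\<lambda>T. if even (card T) then T else insert a T) ` Pow (A - {a}) \<subseteq> {S. S \<subseteq> A \<and> even (card S)}"
    proof (rule image_subsetI)
      fix T assume T: "T \<in> Pow (A - {a})"
      then have "card (insert a T) = Suc (card T)"
        using fin[of T] by (intro card_insert_disjoint) auto
      moreover have "T \<subseteq> A" "insert a T \<subseteq> A"
        using T a by auto
      ultimately show "(if even (card T) then T else insert a T) \<in> {S. S \<subseteq> A \<and> even (card S)}"
        by simp
    qed
  qed auto
  then show ?thesis
    using assms a by (simp add: bij_betw_same_card card_Pow)
qed

text \<open>
  Translation by \<open>1\<close> permutes the field, so summing all elements shows that the cardinality is zero
  in the field.
\<close>

lemma CHAR_eq_card: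
  assumes "prime p" "CARD('k::field) = p"
  shows "CHAR('k) = p"
proof -
  have "card (UNIV :: 'k set) > 0"
    using assms prime_gt_0_nat by metis
  then have fin: "finite (UNIV :: 'k set)"
    by (rule card_ge_0_finite)
  have "(\<Sum>x\<in>UNIV. x + 1) = (\<Sum>x\<in>UNIV. x :: 'k)"
    by (rule sum.reindex_bij_witness[of _ "\<lambda>x. x - 1" "\<lambda>x. x + 1"]) auto
  then have "of_nat p = (0 :: 'k)"
    using assms(2) by (simp add: sum.distrib)
  then have "CHAR('k) dvd p"
    by (simp add: of_nat_eq_0_iff_char_dvd)
  then show ?thesis
    using assms(1) CHAR_not_1 by (metis prime_nat_iff One_nat_def)
qed

text \<open>
  The functional of a set \<open>T\<close> has to vanish on exact forms. If \<open>Z\<close> is empty, all exact forms of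
  multidegree \<open>m\<close> are zero, and the coefficient at \<open>T\<close> of the symbol does it. Otherwise the symbol is
  first multiplied by \<open>\<eta>\<close> of the multidegree, which kills the multiples of \<open>\<eta>\<close>, and the coefficient at
  \<open>T \<union> {i}\<close> is taken; on the basis elements of sets that avoid \<open>i\<close> only the summand \<open>m\<^sub>i \<omega>\<^sub>i\<close>
  contributes to it.
\<close>

lemma dim_component_eq_card_even_subsets:
  fixes m :: "'x::finite \<Rightarrow> nat"
  assumes pos: "\<forall>i. m i > 0"
    and Z: "Z = {} \<and> (\<forall>i. of_nat (m i) = (0 :: 'k::field)) \<or>
      (\<exists>i. Z = {i} \<and> of_nat (m i) \<noteq> (0 :: 'k))"
  shows "B1bar.dim (B1bar_component m :: ('x, 'k) B1bar set)
    = card {S. S \<subseteq> - Z \<and> even (card S)}"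
proof -
  define r where "r = (to_nat :: 'x \<Rightarrow> nat)"
  have r: "inj r"
    by (simp add: r_def)
  interpret grassmann_generators "wedge r :: 'x \<Rightarrow> ('x set, 'k) fun_endo" r
    by (rule grassmann_generators_wedge[OF r])
  let ?I = "{S. S \<subseteq> - Z \<and> even (card S)}"
  let ?\<omega> = "wedge r :: 'x \<Rightarrow> ('x set, 'k) fun_endo"
  let ?s = "\<lambda>S. ordered_word r (\<lambda>i. of_bool (i \<in> S))"
  \<comment> \<open>\<open>d\<close> is the multiplier \<open>1\<close> or \<open>\<eta>\<close>; the union with \<open>Z\<close> in \<open>A\<close> covers both coefficients.\<close>
  define d where "d = (if Z = {} then 1 else \<eta> (ordered_word r m))"
  define A where "A = (\<lambda>T e. endo_apply (d * e) (vac :: 'x set \<Rightarrow> 'k) (Z \<union> T))"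
  define c where "c = (\<lambda>T. symbol_functional m (A T) :: 'x list \<Rightarrow> 'k)"
  have A: "additive (A T)" for T
    unfolding A_def by (rule additive_endo_apply)
  have deg: "m i - of_bool (i \<in> S) + of_bool (i \<in> S) = m i" for S i
    using pos by (simp add: Suc_leI)
  have degree: "\<eta> v = \<eta> (ordered_word r m)" if "\<forall>i. count_list v i = m i" for v
    using that by (intro eta_perm) (simp add: mset_eq_iff_count_list)
  have eta0: "\<eta> v = 0" if Z: "\<forall>i. of_nat (m i) = (0 :: 'k)" and v: "\<forall>i. count_list v i = m i" for v
  proof -
    have "\<eta> v = (\<Sum>i\<in>UNIV. of_nat (m i) * ?\<omega> i)"
      using eta_eq_sum[of UNIV v] v by simp
    moreover have "of_nat (m i) * ?\<omega> i = 0" for i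
      by (rule endo_apply_inject[THEN iffD1]) (simp add: fun_eq_iff endo_apply_of_nat Z)
    ultimately show ?thesis
      by simp
  qed
  have vanish: "A T (symb w * \<eta> u * \<eta> v) = 0" if v: "\<forall>i. count_list v i = m i" for T u v w
  proof (cases "Z = {}")
    case True
    with Z have "\<forall>i. of_nat (m i) = (0 :: 'k)"
      by auto
    with v show ?thesis
      using additive.zero[OF A] by (simp add: eta0)
  next
    case False
    have "\<eta> v * (symb w * \<eta> u * \<eta> v) = \<eta> v * symb w * (\<eta> u * \<eta> v)"
      by (simp only: mult.assoc)
    also have "\<dots> = symb w * (\<eta> v * (\<eta> u * \<eta> v))"
      by (simp only: eta_commute_symb[symmetric] mult.assoc)
    also have "\<eta> v * (\<eta> u * \<eta> v) = 0"
      unfolding eta_eta[of u v] by (simp add: eta_mult_eta)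
    finally have "d * (symb w * \<eta> u * \<eta> v) = 0"
      using False by (simp add: d_def degree[OF v])
    then show ?thesis
      by (simp only: A_def) simp
  qed
  have eval_basis: "lin_ext (c T) (basis_element r m S) = A T (\<Prod>i\<leftarrow>?s S. ?\<omega> i)" if "even (card S)" for S T
  proof -
    have "length (?s S) = card S"
      using distinct_card[of "?s S"] by simp
    then have "lin_ext (c T) (basis_element r m S)
        = A T (symb (ordered_word r (\<lambda>i. m i - of_bool (i \<in> S))) * (\<Prod>i\<leftarrow>?s S. ?\<omega> i))"
      unfolding c_def basis_element_def using that
      by (intro symbol_functional_mon_comm_prod A) (simp_all add: deg)
    then show ?thesis
      by (simp add: symb_sorted sorted_ordered_word)
  qed
  have A_prod: "A T (\<Prod>i\<leftarrow>?s S. ?\<omega> i) \<noteq> 0 \<longleftrightarrow> S = T" if S: "S \<subseteq> - Z" and T: "T \<subseteq> - Z" for S T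
  proof (cases "Z = {}")
    case True
    then show ?thesis
      using wedge_monomial_eq_0[of T "?s S" r] wedge_monomial_neq_0[of "?s S" r]
      by (auto simp: A_def d_def)
  next
    case False
    with Z obtain i where i: "Z = {i}" "of_nat (m i) \<noteq> (0 :: 'k)"
      by auto
    have "A T (\<Prod>i\<leftarrow>?s S. ?\<omega> i) = of_nat (m i) * endo_apply (\<Prod>j\<leftarrow>i # ?s S. wedge r j) (vac :: _ \<Rightarrow> 'k) (insert i T)"
      using wedge_eta_monomial[OF r, of i "?s S" "insert i T" "ordered_word r m"] S i(1)
      by (simp add: A_def d_def)
    moreover have "insert i S = insert i T \<longleftrightarrow> S = T"
      using S T i(1) by auto
    moreover have "distinct (i # ?s S)"
      using S i(1) by auto
    ultimately show ?thesis
      using wedge_monomial_eq_0[of "insert i T" "i # ?s S" r]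
        wedge_monomial_neq_0[of "i # ?s S" r, where 'k = 'k] i(2)
      by (metis list.simps(15) mult_eq_0_iff set_ordered_subset)
  qed
  show ?thesis
  proof (rule dim_B1bar_component[where g = "basis_element r m" and c = c])
    show "basis_element r m S \<in> fa_component m" for S
      unfolding basis_element_def by (rule mon_comm_prod_in_component) (simp add: deg)
    let ?W = "fa.span (B1bar_kernel fa_scale \<union> basis_element r m ` ?I) :: ('x, 'k) free_algebra set"
    have Z': "Z = {} \<or> (\<exists>i. Z = {i} \<and> of_nat (m i) \<noteq> (0 :: 'k))"
      using Z by auto
    have mon: "mon w * comm_prod [] \<in> ?W" if "\<And>i. count_list w i = m i" for w
    proof (rule mon_comm_prod_mem[OF fa.subspace_span _ _ Z'])
      show "basis_element r m S \<in> ?W" if "even (card S)" "S \<inter> Z = {}" for S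
        using that by (intro fa.span_base) auto
    qed (use that in \<open>auto intro: fa.span_base\<close>)
    show "fa_component m \<subseteq> ?W"
    proof
      fix f :: "('x, 'k) free_algebra"
      assume f: "f \<in> fa_component m"
      have "(\<Sum>w\<in>Poly_Mapping.keys f. fa_scale (Poly_Mapping.lookup f w) (mon (letters w))) \<in> ?W"
        using f mon by (intro fa.span_sum fa.span_scale) (simp add: fa_component_def)
      then show "f \<in> ?W"
        by (simp flip: sum_monomials)
    qed
    show "lin_ext (c S) f = 0" if "f \<in> B1bar_kernel fa_scale" for S f
      unfolding c_def by (rule symbol_functional_kernel[OF A vanish that])
  qed (use eval_basis A_prod in auto)
qed

theorem corollary3p11:
  fixes p n :: nat and m :: "'x::finite \<Rightarrow> nat"
  assumes "prime p" and "CARD('k::field) = p" and "CARD('x) = n"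
    and "\<forall>i. m i > 0"
  shows "(n \<ge> 2 \<longrightarrow> (\<exists>i. \<not> p dvd m i) \<longrightarrow>
           B1bar.dim (B1bar_component m :: ('x, 'k) B1bar set) = 2 ^ (n - 2)) \<and>
         ((\<forall>i. p dvd m i) \<longrightarrow>
           B1bar.dim (B1bar_component m :: ('x, 'k) B1bar set) = 2 ^ (n - 1))"
proof (intro conjI impI)
  have dvd: "of_nat k = (0 :: 'k) \<longleftrightarrow> p dvd k" for k
    using CHAR_eq_card[OF assms(1,2)] by (simp add: of_nat_eq_0_iff_char_dvd)
  show "B1bar.dim (B1bar_component m :: ('x, 'k) B1bar set) = 2 ^ (n - 1)" if "\<forall>i. p dvd m i"
    using dim_component_eq_card_even_subsets[OF assms(4), of "{}", where 'k = 'k]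
      card_even_subsets[of "UNIV :: 'x set"] that assms(3) by (simp add: dvd)
  assume n: "n \<ge> 2" and "\<exists>i. \<not> p dvd m i"
  then obtain i where i: "\<not> p dvd m i" by auto
  have card: "card (- {i}) = n - 1"
    using assms(3) by (simp add: card_Diff_singleton Compl_eq_Diff_UNIV)
  then have "- {i} \<noteq> {}"
    using n by (metis card.empty diff_is_0_eq not_less_eq_eq numeral_2_eq_2 One_nat_def)
  then have "card {S. S \<subseteq> - {i} \<and> even (card S)} = 2 ^ (n - 2)"
    using card_even_subsets[of "- {i}"] by (simp add: card)
  then show "B1bar.dim (B1bar_component m :: ('x, 'k) B1bar set) = 2 ^ (n - 2)"
    using dim_component_eq_card_even_subsets[OF assms(4), of "{i}", where 'k = 'k] i by (simp add: dvd)
qed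

end
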